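(* Let $k\in\mathbb{N}$ and let $a_1,\ldots,a_k$ be real numbers such that $\sum_{j=i}^ka_j>0$ for all $1\le i\le k$. For each $n\in\mathbb{N}$ with $n-a_i\sqrt n>0$ for all $i\in[k]$, consider the gap Jackson network $\boldsymbol{Q}$ with parameters $\lambda_i=\lambda^{(n)}_i=n-a_i\sqrt n$ and $\mu_i=\mu^{(n)}_i=n$, $i\in[k]$. Then $\boldsymbol{Q}$ has a unique stationary distribution. Denoting the unique stationary distribution of $\boldsymbol{Q}^n:=\boldsymbol{Q}/\sqrt n$ by $\pi^{(n)}$, as $n\to\infty$ $\pi^{(n)}$ converges weakly to $\bigotimes_{i=1}^k\mathrm{Exp}\big(\sum_{j=i}^ka_j\big)$.
   Context: $[k]=\{1,\ldots,k\}$; $\mathbb{N}_0=\{0,1,2,\ldots\}$; $\mathrm{Exp}(\theta)$ is the exponential law with mean $\theta^{-1}$. Gap Jackson network with positive parameters $\{\lambda_i\}_{i\in[k]}$, $\{\mu_i\}_{i\in[k]}$: the open Jackson network $\boldsymbol{Q}=(Q^1,\ldots,Q^k)$ on $\mathbb{N}_0^k$ with external arrival rates $\bar\lambda_i=0$ for $i\in[k-1]$, $\bar\lambda_k=\lambda_k$; service rates $\bar\mu_1=\mu_1$, $\bar\mu_i=\lambda_{i-1}+\mu_i$ for $2\le i\le k$; and routing probabilities $P_{1,2}=1$, $P_{k,k-1}=\frac{\lambda_{k-1}}{\lambda_{k-1}+\mu_k}$, and, for $2\le i\le k-1$, $P_{i,i-1}=\frac{\lambda_{i-1}}{\lambda_{i-1}+\mu_i}$,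 $P_{i,i+1}=\frac{\mu_i}{\lambda_{i-1}+\mu_i}$, all other $P_{ij}=0$ (for $k=1$, $P=0$). That is, $\boldsymbol{Q}$ is the continuous-time Markov chain with transitions $\boldsymbol{q}\to\boldsymbol{q}+e_k$ at rate $\bar\lambda_k$; and, when $q_i>0$, $\boldsymbol{q}\to\boldsymbol{q}-e_i+e_j$ at rate $\bar\mu_iP_{ij}$ and $\boldsymbol{q}\to\boldsymbol{q}-e_i$ at rate $\bar\mu_i(1-\sum_jP_{ij})$. *)

theory Defs
  imports "HOL-Probability.Probability"
begin

text \<open>
  A continuous-time Markov chain on \<open>S\<close> with jump rates \<open>r x y\<close> (for \<open>x \<noteq> y\<close>) is
  given by its transition function: \<open>P t x\<close> is the law at time \<open>t\<close> of the chain
  started in \<open>x\<close>. The values of \<open>P\<close> at negative times or outside \<open>S\<close> are irrelevant,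
  as are the values \<open>r x x\<close>.
\<close>

definition generator :: "'s set \<Rightarrow> ('s \<Rightarrow> 's \<Rightarrow> real) \<Rightarrow> 's \<Rightarrow> 's \<Rightarrow> real" where
  "generator S r x y = (if x = y then - (\<Sum>\<^sub>\<infinity>z\<in>S - {x}. r x z) else r x y)"

definition ctmc :: "'s set \<Rightarrow> ('s \<Rightarrow> 's \<Rightarrow> real) \<Rightarrow> (real \<Rightarrow> 's \<Rightarrow> 's pmf) \<Rightarrow> bool" where
  "ctmc S r P \<longleftrightarrow>
     (\<forall>x\<in>S. \<forall>t\<ge>0. set_pmf (P t x) \<subseteq> S) \<and>
     (\<forall>x\<in>S. P 0 x = return_pmf x) \<and>
     (\<forall>x\<in>S. \<forall>s\<ge>0. \<forall>t\<ge>0. P (s + t) x = bind_pmf (P s x) (P t)) \<and>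
     (\<forall>x\<in>S. \<forall>y\<in>S.
        ((\<lambda>t. pmf (P t x) y) has_real_derivative generator S r x y) (at 0 within {0..}))"

definition stationary_for :: "'s set \<Rightarrow> (real \<Rightarrow> 's \<Rightarrow> 's pmf) \<Rightarrow> 's pmf \<Rightarrow> bool" where
  "stationary_for S P p \<longleftrightarrow> set_pmf p \<subseteq> S \<and> (\<forall>t\<ge>0. bind_pmf p (P t) = p)"

definition stationary_distribution :: "'s set \<Rightarrow> (real \<Rightarrow> 's \<Rightarrow> 's pmf) \<Rightarrow> 's pmf" where
  "stationary_distribution S P = (THE p. stationary_for S P p)"

text \<open>
  Vectors indexed by \<open>{1..k}\<close> are extensional functions, so that \<open>{1..k} \<rightarrow>\<^sub>E UNIV\<close>
  over \<^typ>\<open>nat\<close> stands for the set of \<open>k\<close>-tuples of natural numbers.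
\<close>

definition states :: "nat \<Rightarrow> (nat \<Rightarrow> nat) set" where
  "states k = {1..k} \<rightarrow>\<^sub>E UNIV"

definition incr :: "nat \<Rightarrow> (nat \<Rightarrow> nat) \<Rightarrow> (nat \<Rightarrow> nat)" where
  "incr i x = x(i := x i + 1)"

definition decr :: "nat \<Rightarrow> (nat \<Rightarrow> nat) \<Rightarrow> (nat \<Rightarrow> nat)" where
  "decr i x = x(i := x i - 1)"

text \<open>
  Jump rates of the open Jackson network with external arrival rates \<open>\<alpha>\<close>, service
  rates \<open>\<beta>\<close> and routing probabilities \<open>R\<close>. The three sums are over the external
  arrivals, the services followed by a transfer, and the services followed by a
  departure from the network; each picks out the events that lead from \<open>x\<close> to \<open>y\<close>.
\<close>

definition jackson_rate ::
    "nat \<Rightarrow> (nat \<Rightarrow> real) \<Rightarrow> (nat \<Rightarrow> real) \<Rightarrow> (nat \<Rightarrow> nat \<Rightarrow> real) \<Rightarrow>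
     (nat \<Rightarrow> nat) \<Rightarrow> (nat \<Rightarrow> nat) \<Rightarrow> real" where
  "jackson_rate k \<alpha> \<beta> R x y =
     (\<Sum>i=1..k. if y = incr i x then \<alpha> i else 0) +
     (\<Sum>i=1..k. \<Sum>j=1..k. if x i > 0 \<and> y = incr j (decr i x) then \<beta> i * R i j else 0) +
     (\<Sum>i=1..k. if x i > 0 \<and> y = decr i x then \<beta> i * (1 - (\<Sum>j=1..k. R i j)) else 0)"

definition gap_arrival :: "nat \<Rightarrow> (nat \<Rightarrow> real) \<Rightarrow> nat \<Rightarrow> real" where
  "gap_arrival k lam i = (if i = k then lam k else 0)"

definition gap_service :: "(nat \<Rightarrow> real) \<Rightarrow> (nat \<Rightarrow> real) \<Rightarrow> nat \<Rightarrow> real" where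
  "gap_service lam mu i = (if i = 1 then mu 1 else lam (i - 1) + mu i)"

definition gap_routing :: "nat \<Rightarrow> (nat \<Rightarrow> real) \<Rightarrow> (nat \<Rightarrow> real) \<Rightarrow> nat \<Rightarrow> nat \<Rightarrow> real" where
  "gap_routing k lam mu i j =
     (if i = 1 \<and> j = 2 \<and> 2 \<le> k then 1
      else if 2 \<le> i \<and> i \<le> k \<and> j = i - 1 then lam (i - 1) / (lam (i - 1) + mu i)
      else if 2 \<le> i \<and> i < k \<and> j = i + 1 then mu i / (lam (i - 1) + mu i)
      else 0)"

definition gap_jackson_rate ::
    "nat \<Rightarrow> (nat \<Rightarrow> real) \<Rightarrow> (nat \<Rightarrow> real) \<Rightarrow> (nat \<Rightarrow> nat) \<Rightarrow> (nat \<Rightarrow> nat) \<Rightarrow> real" where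
  "gap_jackson_rate k lam mu =
     jackson_rate k (gap_arrival k lam) (gap_service lam mu) (gap_routing k lam mu)"

text \<open>
  The law of \<open>X / c\<close> as a Borel measure on \<open>k\<close>-dimensional space, where \<open>X\<close> has law \<open>p\<close>.
\<close>

definition scaled_law :: "nat \<Rightarrow> real \<Rightarrow> (nat \<Rightarrow> nat) pmf \<Rightarrow> (nat \<Rightarrow> real) measure" where
  "scaled_law k c p =
     distr (measure_pmf p) (\<Pi>\<^sub>M i\<in>{1..k}. borel) (\<lambda>x. \<lambda>i\<in>{1..k}. real (x i) / c)"

text \<open>
  The library's \<^const>\<open>weak_conv_m\<close> only covers measures on the real line, so weak
  convergence is stated through bounded continuous test functions on a topology.
\<close>

definition weakly_converges_in ::
    "'a topology \<Rightarrow> (nat \<Rightarrow> 'a measure) \<Rightarrow> 'a measure \<Rightarrow> bool" where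
  "weakly_converges_in X M N \<longleftrightarrow>
     (\<forall>f. continuous_map X euclideanreal f \<and> bounded (f ` topspace X) \<longrightarrow>
        (\<lambda>n. \<integral>x. f x \<partial>M n) \<longlonglongrightarrow> (\<integral>x. f x \<partial>N))"

end

theory Submission
  imports Defs "HOL-Real_Asymp.Real_Asymp"
begin

text \<open>
  The gap Jackson network is a line of queues: neighbours \<open>i\<close> and \<open>i + 1\<close> exchange
  customers at rates \<open>mu i\<close> and \<open>lam i\<close>, and only queue \<open>k\<close> communicates with the outside,
  at rates \<open>lam k\<close> and \<open>mu k\<close>. Balancing the flow through each cut of the line shows that
  the network is reversible with respect to the product of geometric laws with ratios
  \<open>\<rho> i = (\<Prod>j=i..k. lam j / mu j)\<close>, provided that these are below \<open>1\<close>
  (\<open>gap_rate_detailed_balance\<close>). With the given parameters the ratio is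
  \<open>(\<Prod>j=i..k. 1 - a j / sqrt n)\<close>, which is at most
  \<open>exp (- (\<Sum>j=i..k. a j) / sqrt n)\<close> and hence below \<open>1\<close>.

  A chain is given here by its transition function, of which only the derivatives at time
  \<open>0\<close> are prescribed. Two general facts lead from the rates to stationary distributions.
  Under detailed balance and bounded exit rates, a time step of length \<open>h\<close> changes the
  reversible law by \<open>o(h)\<close> in total variation; splitting a given time into ever shorter
  steps shows that the law does not change at all (\<open>reversible_stationary\<close>). And if every
  state can reach every other one, two stationary laws coincide, since the pointwise
  minimum of two different ones would lose mass (\<open>stationary_for_unique\<close>). For the gap
  network every state reaches the empty one, and by reversibility it is also reached from it.

  For the limit, note that \<open>- sqrt n * ln (\<rho> i)\<close> tends to \<open>\<Sum>j=i..k. a j\<close>. A geometric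
  variable with ratio \<open>\<rho>\<close> is an exponential variable rounded down to a grid
  (\<open>geometric_eq_floor_exponential\<close>), and after scaling the mesh of this grid is of order
  \<open>1 / sqrt n\<close>. Rounding the limit vector itself thus realises all the scaled stationary laws
  on one probability space, where they converge pointwise
  (\<open>weakly_converges_scaled_geometric\<close>).
\<close>

section \<open>Stationary distributions of continuous-time Markov chains\<close>

lemma ctmcD:
  assumes "ctmc S r P" and "x \<in> S"
  shows ctmc_0: "P 0 x = return_pmf x"
    and ctmc_add: "0 \<le> s \<Longrightarrow> 0 \<le> t \<Longrightarrow> P (s + t) x = bind_pmf (P s x) (P t)"
    and ctmc_deriv: "y \<in> S \<Longrightarrow>
      ((\<lambda>t. pmf (P t x) y) has_real_derivative generator S r x y) (at 0 within {0..})"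
  using assms unfolding ctmc_def by blast+

lemma sum_le_pmf_bind:
  assumes "finite F"
  shows "(\<Sum>x\<in>F. pmf p x * pmf (K x) y) \<le> pmf (bind_pmf p K) y"
proof -
  have "(\<Sum>x\<in>F. pmf p x * pmf (K x) y)
      = measure_pmf.expectation p (\<lambda>x. indicator F x * pmf (K x) y)"
    using assms by (subst integral_measure_pmf_real[of F]) (auto simp: indicator_def mult.commute)
  also have "\<dots> \<le> measure_pmf.expectation p (\<lambda>x. pmf (K x) y)"
    by (intro integral_mono measure_pmf.integrable_const_bound[where B=1])
       (auto simp: indicator_def pmf_le_1)
  finally show ?thesis
    by (simp add: pmf_bind)
qed

lemma ctmc_pmf_add_ge:
  assumes "ctmc S r P" "x \<in> S" "0 \<le> s" "0 \<le> t"
  shows "pmf (P s x) y * pmf (P t y) z \<le> pmf (P (s + t) x) z"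
  using sum_le_pmf_bind[of "{y}" "P s x" "P t" z] ctmc_add[OF assms] by simp

lemma ctmc_diag_power:
  assumes "ctmc S r P" "x \<in> S" "0 \<le> h"
  shows "pmf (P h x) x ^ n \<le> pmf (P (real n * h) x) x"
proof (induction n)
  case 0
  then show ?case using ctmc_0[OF assms(1,2)] by simp
next
  case (Suc n)
  have "pmf (P h x) x ^ Suc n \<le> pmf (P h x) x * pmf (P (real n * h) x) x"
    using Suc by (simp add: mult_left_mono)
  also have "\<dots> \<le> pmf (P (h + real n * h) x) x"
    by (rule ctmc_pmf_add_ge[OF assms(1,2)]) (use assms in auto)
  finally show ?case by (simp add: algebra_simps)
qed

lemma filterlim_inverse_at_0_within:
  assumes "0 < (t::real)"
  shows "filterlim (\<lambda>n. t / real n) (at 0 within {0..}) sequentially"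
proof -
  have "(\<lambda>n. t / real n) \<longlonglongrightarrow> 0"
    by (rule lim_const_over_n)
  moreover have "\<forall>\<^sub>F n in sequentially. t / real n \<in> {0..} \<and> t / real n \<noteq> 0"
    using eventually_gt_at_top[of 0] by eventually_elim (use assms in auto)
  ultimately show ?thesis
    by (simp add: filterlim_at)
qed

text \<open>
  The bound is linear in \<open>t\<close> with a constant that is uniform over the states as soon
  as the exit rates are. The derivative at \<open>0\<close> gives it only for small times that
  depend on \<open>x\<close>; splitting \<open>[0, t]\<close> into \<open>n\<close> such steps and applying Bernoulli's
  inequality to \<open>(1 - C t / n) ^ n\<close> removes that dependence. Taking \<open>C\<close> strictly
  above the exit rate leaves room for the error term of the derivative.
\<close>

lemma ctmc_diag_lower:
  assumes P: "ctmc S r P" "x \<in> S" and C: "(\<Sum>\<^sub>\<infinity>z\<in>S - {x}. r x z) < C" and "0 \<le> t"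
    and "0 \<le> C"
  shows "1 - C * t \<le> pmf (P t x) x"
proof (cases "t = 0")
  case True
  then show ?thesis using ctmc_0[OF P] by simp
next
  case False
  with \<open>0 \<le> t\<close> have t: "0 < t" by simp
  define g where "g h = (pmf (P h x) x - pmf (P 0 x) x) / (h - 0)" for h
  have "(g \<longlongrightarrow> generator S r x x) (at 0 within {0..})"
    using ctmc_deriv[OF P P(2)] unfolding has_field_derivative_iff g_def .
  then have "(\<lambda>n. g (t / real n)) \<longlonglongrightarrow> generator S r x x"
    by (rule filterlim_compose) (rule filterlim_inverse_at_0_within[OF t])
  moreover have "- C < generator S r x x"
    using C by (simp add: generator_def)
  ultimately have "\<forall>\<^sub>F n in sequentially. - C < g (t / real n)"
    by (rule order_tendstoD)
  moreover have "\<forall>\<^sub>F n in sequentially. C * t < real n"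
    using eventually_gt_at_top by (rule eventually_compose_filterlim) (rule filterlim_real_sequentially)
  ultimately have "\<forall>\<^sub>F n in sequentially. 0 < n \<and> - C < g (t / real n) \<and> C * t < real n"
    using eventually_gt_at_top[of 0] by eventually_elim simp
  then obtain n where n: "0 < n" "- C < g (t / real n)" "C * t < real n"
    by (metis (mono_tags, lifting) eventually_sequentially order_refl)
  have step: "1 - C * t / real n \<le> pmf (P (t / real n) x) x"
    using n t ctmc_0[OF P] by (simp add: g_def field_simps)
  have "1 - C * t = 1 + real n * (- (C * t / real n))"
    using n by simp
  also have "\<dots> \<le> (1 + - (C * t / real n)) ^ n"
    by (rule Bernoulli_inequality) (use n in \<open>simp add: field_simps\<close>)
  also have "\<dots> \<le> pmf (P (t / real n) x) x ^ n"
    using step n by (intro power_mono) (auto simp: field_simps)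
  also have "\<dots> \<le> pmf (P (real n * (t / real n)) x) x"
    by (rule ctmc_diag_power[OF P]) (use t in auto)
  finally show ?thesis using n by simp
qed

text \<open>
  Since \<^const>\<open>ennreal\<close> truncates at \<open>0\<close>, the last integral is the sum of the
  positive parts of \<open>pmf p x - pmf q x\<close>, that is, the total variation distance.
\<close>

lemma nn_integral_pmf_le_deficit:
  assumes "\<And>x. f x \<le> 1"
  shows "(\<integral>\<^sup>+x. f x \<partial>measure_pmf p)
       \<le> (\<integral>\<^sup>+x. f x \<partial>measure_pmf q) + (\<integral>\<^sup>+x. ennreal (1 - pmf q x / pmf p x) \<partial>measure_pmf p)"
proof -
  have "ennreal (pmf p x) * f x
      \<le> ennreal (pmf q x) * f x + ennreal (pmf p x) * ennreal (1 - pmf q x / pmf p x)" for x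
  proof (cases "pmf p x = 0")
    case False
    then have px: "pmf p x > 0" by (simp add: pmf_pos)
    let ?d = "ennreal (pmf p x) * ennreal (1 - pmf q x / pmf p x)"
    have "pmf p x \<le> pmf q x + pmf p x * max 0 (1 - pmf q x / pmf p x)"
      using px by (auto simp: max_def field_simps)
    then have "ennreal (pmf p x) \<le> ennreal (pmf q x + pmf p x * max 0 (1 - pmf q x / pmf p x))"
      by (rule ennreal_leI)
    also have "\<dots> = ennreal (pmf q x) + ?d"
      by (simp add: ennreal_plus ennreal_mult max_def ennreal_neg)
    finally have "ennreal (pmf p x) * f x \<le> (ennreal (pmf q x) + ?d) * f x"
      by (rule mult_right_mono) simp
    also have "\<dots> = ennreal (pmf q x) * f x + ?d * f x"
      by (simp add: distrib_right)
    also have "?d * f x \<le> ?d * 1"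
      by (rule mult_left_mono[OF assms]) simp
    finally show ?thesis by (simp add: add_left_mono)
  qed simp
  then show ?thesis
    by (auto simp: nn_integral_measure_pmf nn_integral_add[symmetric] intro!: nn_integral_mono)
qed

text \<open>
  Deficits add up along the semigroup because a Markov kernel maps functions
  bounded by \<open>1\<close> to functions bounded by \<open>1\<close>. Hence \<open>n\<close> steps of length \<open>h\<close> lose at
  most \<open>n\<close> times what one step loses, and a law that loses only \<open>o(h)\<close> per step
  loses nothing.
\<close>

lemma nn_integral_semigroup_deficit:
  assumes P: "ctmc S r P" and p: "set_pmf p \<subseteq> S" and h: "0 \<le> h"
    and f: "\<And>x. f x \<le> 1"
  defines "\<delta> \<equiv> \<integral>\<^sup>+x. ennreal (1 - pmf (bind_pmf p (P h)) x / pmf p x) \<partial>measure_pmf p"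
  shows "(\<integral>\<^sup>+x. f x \<partial>measure_pmf p)
       \<le> (\<integral>\<^sup>+x. f x \<partial>measure_pmf (bind_pmf p (P (real n * h)))) + of_nat n * \<delta>"
proof (induction n)
  case 0
  have "bind_pmf p (P 0) = bind_pmf p return_pmf"
    using p ctmc_0[OF P] by (intro bind_pmf_cong) auto
  then show ?case by (simp add: bind_return_pmf' del: nn_integral_bind_pmf)
next
  case (Suc n)
  let ?g = "\<lambda>x. \<integral>\<^sup>+y. f y \<partial>measure_pmf (P (real n * h) x)"
  have g: "?g x \<le> 1" for x
  proof -
    have "?g x \<le> (\<integral>\<^sup>+y. 1 \<partial>measure_pmf (P (real n * h) x))"
      by (intro nn_integral_mono f)
    then show ?thesis by simp
  qed
  have "bind_pmf p (P (real (Suc n) * h)) = bind_pmf p (\<lambda>x. bind_pmf (P h x) (P (real n * h)))"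
    using p h by (intro bind_pmf_cong)
      (auto simp: ctmc_add[OF P, symmetric] algebra_simps)
  then have *: "bind_pmf p (P (real (Suc n) * h)) = bind_pmf (bind_pmf p (P h)) (P (real n * h))"
    by (simp add: bind_assoc_pmf)
  have "(\<integral>\<^sup>+x. f x \<partial>measure_pmf p) \<le> (\<integral>\<^sup>+x. ?g x \<partial>measure_pmf p) + of_nat n * \<delta>"
    using Suc by simp
  also have "(\<integral>\<^sup>+x. ?g x \<partial>measure_pmf p) \<le> (\<integral>\<^sup>+x. ?g x \<partial>measure_pmf (bind_pmf p (P h))) + \<delta>"
    unfolding \<delta>_def by (rule nn_integral_pmf_le_deficit[OF g])
  also have "(\<integral>\<^sup>+x. ?g x \<partial>measure_pmf (bind_pmf p (P h)))
    = (\<integral>\<^sup>+x. f x \<partial>measure_pmf (bind_pmf p (P (real (Suc n) * h))))"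
    unfolding * by simp
  finally show ?case
    by (simp add: algebra_simps del: nn_integral_bind_pmf)
qed

lemma pmf_eqI_le:
  assumes "\<And>x. pmf p x \<le> pmf q x"
  shows "p = q"
proof (rule pmf_eqI, rule ccontr)
  fix x assume "pmf p x \<noteq> pmf q x"
  with assms[of x] have x: "pmf p x < pmf q x" by simp
  have *: "measure_pmf.prob p (- {x}) \<le> measure_pmf.prob q (- {x})"
    unfolding measure_pmf_conv_infsetsum by (rule infsetsum_mono) (auto intro: assms)
  have "measure_pmf.prob r (- {x}) = 1 - pmf r x" for r
    using measure_pmf.prob_compl[of "{x}" r] by (simp add: pmf.rep_eq Compl_eq_Diff_UNIV)
  with * x show False by simp
qed

text \<open>
  Detailed balance turns the inflow into \<open>y\<close> into \<open>w y\<close> times the outflow from \<open>y\<close>,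
  which the diagonal entry of the generator cancels. The sum ranges over \<open>y\<close> and its
  successors, which under detailed balance include every predecessor that carries
  weight.
\<close>

lemma sum_generator_detailed_balance:
  assumes y: "y \<in> S"
    and bal: "\<And>x. x \<in> S \<Longrightarrow> x \<noteq> y \<Longrightarrow> w x * r x y = w y * r y x"
    and fin: "finite {z \<in> S - {y}. r y z \<noteq> 0}"
  shows "(\<Sum>x\<in>insert y {z \<in> S - {y}. r y z \<noteq> 0}. w x * generator S r x y) = 0"
proof -
  let ?F = "{z \<in> S - {y}. r y z \<noteq> 0}"
  have "(\<Sum>\<^sub>\<infinity>z\<in>S - {y}. r y z) = (\<Sum>\<^sub>\<infinity>z\<in>?F. r y z)"
    by (rule infsum_cong_neutral) auto
  also have "\<dots> = (\<Sum>z\<in>?F. r y z)" using fin by simp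
  finally have "w y * generator S r y y = - (\<Sum>z\<in>?F. w y * r y z)"
    by (simp add: generator_def sum_distrib_left)
  moreover have "(\<Sum>x\<in>?F. w x * generator S r x y) = (\<Sum>z\<in>?F. w y * r y z)"
    by (rule sum.cong) (auto simp: generator_def bal)
  ultimately show ?thesis
    using fin by (subst sum.insert) auto
qed

text \<open>
  The transition function is known only through its derivatives at time \<open>0\<close>, entry by
  entry, so the equation "weight times generator is zero" has to be integrated in
  time. Let \<open>q n\<close> be the law after time \<open>t / n\<close> started from \<open>p\<close>. By
  \<open>nn_integral_semigroup_deficit\<close> it suffices that \<open>n\<close> times the deficit of \<open>q n\<close> tends
  to \<open>0\<close>. Relative to \<open>p\<close>, this quantity is the integral of
  \<open>n * (1 - q n y / p y)\<close>, cut off at \<open>0\<close>, which is at most \<open>C * t\<close> by the uniform bound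
  on the diagonal and has pointwise limit \<open>0\<close> by detailed balance; dominated
  convergence concludes. A pmf that lies below another one equals it.
\<close>

lemma reversible_stationary:
  assumes P: "ctmc S r P" and p: "set_pmf p \<subseteq> S"
    and bal: "\<And>x y. x \<in> S \<Longrightarrow> y \<in> S \<Longrightarrow> x \<noteq> y \<Longrightarrow> pmf p x * r x y = pmf p y * r y x"
    and fin: "\<And>x. x \<in> S \<Longrightarrow> finite {z \<in> S - {x}. r x z \<noteq> 0}"
    and C: "\<And>x. x \<in> S \<Longrightarrow> (\<Sum>\<^sub>\<infinity>z\<in>S - {x}. r x z) < C" "0 \<le> C"
  shows "stationary_for S P p"
proof -
  have "bind_pmf p (P t) = p" if "0 \<le> t" for t
  proof (cases "t = 0")
    case True
    have "bind_pmf p (P 0) = bind_pmf p return_pmf"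
      using p ctmc_0[OF P] by (intro bind_pmf_cong) auto
    then show ?thesis using True by (simp add: bind_return_pmf')
  next
    case False
    with that have t: "0 < t" by simp
    define q where "q n = bind_pmf p (P (t / real n))" for n :: nat
    define u where "u n y = ennreal (real n * (1 - pmf (q n) y / pmf p y))" for n :: nat and y
    have "(\<lambda>n. \<integral>\<^sup>+y. u n y \<partial>measure_pmf p) \<longlonglongrightarrow> (\<integral>\<^sup>+y. 0 \<partial>measure_pmf p)"
    proof (rule nn_integral_dominated_convergence[where w = "\<lambda>_. ennreal (C * t)"])
      fix n :: nat
      show "AE y in measure_pmf p. u n y \<le> ennreal (C * t)"
      proof (rule AE_pmfI)
        fix y assume y: "y \<in> set_pmf p"
        then have py: "0 < pmf p y" by (simp add: pmf_positive_iff)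
        show "u n y \<le> ennreal (C * t)"
        proof (cases "n = 0")
          case False
          have "pmf p y * (1 - C * (t / real n)) \<le> pmf p y * pmf (P (t / real n) y) y"
            using ctmc_diag_lower[OF P _ C(1) _ C(2), of y "t / real n"] y p t
            by (intro mult_left_mono) auto
          also have "\<dots> \<le> pmf (q n) y"
            using sum_le_pmf_bind[of "{y}" p "P (t / real n)" y] by (simp add: q_def)
          finally have "real n * (1 - pmf (q n) y / pmf p y) \<le> C * t"
            using py False by (simp add: field_simps)
          then show ?thesis
            unfolding u_def by (rule ennreal_leI)
        qed (simp add: u_def)
      qed
    next
      show "AE y in measure_pmf p. (\<lambda>n. u n y) \<longlonglongrightarrow> 0"
      proof (rule AE_pmfI)
        fix y assume y': "y \<in> set_pmf p"
        then have py: "0 < pmf p y" and y: "y \<in> S" using p by (auto simp: pmf_positive_iff)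
        \<comment> \<open>A finite set of starting points already gives a lower bound for \<open>q n y\<close>, so
            no exchange of an infinite sum with the derivative is involved.\<close>
        define F where "F = insert y {z \<in> S - {y}. r y z \<noteq> 0}"
        have F: "finite F" "F \<subseteq> S" using fin[OF y] y by (auto simp: F_def)
        define \<phi> where "\<phi> h = (\<Sum>x\<in>F. pmf p x * pmf (P h x) y)" for h
        have "(\<phi> has_real_derivative (\<Sum>x\<in>F. pmf p x * generator S r x y)) (at 0 within {0..})"
          unfolding \<phi>_def using F y
          by (intro DERIV_sum DERIV_cmult ctmc_deriv[OF P]) auto
        also have "(\<Sum>x\<in>F. pmf p x * generator S r x y) = 0"
          unfolding F_def using bal fin y by (intro sum_generator_detailed_balance) auto
        finally have "((\<lambda>h. (\<phi> h - \<phi> 0) / (h - 0)) \<longlongrightarrow> 0) (at 0 within {0..})"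
          unfolding has_field_derivative_iff .
        from filterlim_compose[OF this filterlim_inverse_at_0_within[OF t]]
        have lim: "(\<lambda>n. (\<phi> (t / real n) - \<phi> 0) / (t / real n)) \<longlonglongrightarrow> 0" by simp
        have "\<phi> 0 = (\<Sum>x\<in>F. if x = y then pmf p y else 0)"
          unfolding \<phi>_def using F ctmc_0[OF P] by (intro sum.cong) (auto simp: subset_iff)
        also have "\<dots> = pmf p y" using F by (simp add: F_def)
        finally have \<phi>0: "\<phi> 0 = pmf p y" .
        have "(\<lambda>n. ennreal (- (t / pmf p y) * ((\<phi> (t / real n) - \<phi> 0) / (t / real n))))
                \<longlonglongrightarrow> ennreal (- (t / pmf p y) * 0)"
          by (intro tendsto_ennrealI tendsto_mult_left lim)
        then have lim': "(\<lambda>n. ennreal (- (t / pmf p y) * ((\<phi> (t / real n) - \<phi> 0) / (t / real n))))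
                \<longlonglongrightarrow> 0" by simp
        have le: "u n y \<le> ennreal (- (t / pmf p y) * ((\<phi> (t / real n) - \<phi> 0) / (t / real n)))" for n
        proof (cases "n = 0")
          case False
          have "\<phi> (t / real n) \<le> pmf (q n) y"
            unfolding \<phi>_def q_def by (rule sum_le_pmf_bind[OF F(1)])
          then show ?thesis
            unfolding u_def \<phi>0 using False t py by (intro ennreal_leI) (simp add: field_simps)
        qed (simp add: u_def)
        show "(\<lambda>n. u n y) \<longlonglongrightarrow> 0"
          by (rule tendsto_sandwich[OF _ _ tendsto_const lim'])
            (simp, rule always_eventually, rule allI, rule le)
      qed
    qed (auto simp: ennreal_mult_less_top)
    then have lim: "(\<lambda>n. \<integral>\<^sup>+y. u n y \<partial>measure_pmf p) \<longlonglongrightarrow> 0" by simp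
    have le: "ennreal (pmf p y) \<le> ennreal (pmf (bind_pmf p (P t)) y)" for y
    proof -
      have bnd: "ennreal (pmf p y)
         \<le> ennreal (pmf (bind_pmf p (P t)) y) + (\<integral>\<^sup>+z. u n z \<partial>measure_pmf p)" if "n > 0" for n
      proof -
        have "(\<integral>\<^sup>+x. indicator {y} x \<partial>measure_pmf p)
           \<le> (\<integral>\<^sup>+x. indicator {y} x \<partial>measure_pmf (bind_pmf p (P (real n * (t / real n)))))
             + of_nat n * (\<integral>\<^sup>+x. ennreal (1 - pmf (q n) x / pmf p x) \<partial>measure_pmf p)"
          unfolding q_def
          by (rule nn_integral_semigroup_deficit[OF P p]) (use t in \<open>auto simp: indicator_def\<close>)
        also have "of_nat n * (\<integral>\<^sup>+x. ennreal (1 - pmf (q n) x / pmf p x) \<partial>measure_pmf p)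
           = (\<integral>\<^sup>+z. u n z \<partial>measure_pmf p)"
          by (simp add: u_def nn_integral_cmult[symmetric] ennreal_mult' ennreal_of_nat_eq_real_of_nat)
        also have "real n * (t / real n) = t" using that by simp
        finally show ?thesis
          by (simp add: emeasure_pmf_single del: nn_integral_bind_pmf emeasure_bind_pmf)
      qed
      have "(\<lambda>n. ennreal (pmf (bind_pmf p (P t)) y) + (\<integral>\<^sup>+z. u n z \<partial>measure_pmf p))
          \<longlonglongrightarrow> ennreal (pmf (bind_pmf p (P t)) y) + 0"
        by (intro tendsto_add tendsto_const lim)
      then have "ennreal (pmf p y) \<le> ennreal (pmf (bind_pmf p (P t)) y) + 0"
        by (rule tendsto_lowerbound)
           (auto intro!: eventually_mono[OF eventually_gt_at_top[of 0]] bnd)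
      then show ?thesis by simp
    qed
    have "p = bind_pmf p (P t)"
      by (rule pmf_eqI_le) (use le in simp)
    then show ?thesis by simp
  qed
  with p show ?thesis by (simp add: stationary_for_def)
qed

lemma ctmc_reaches:
  assumes P: "ctmc S r P"
    and path: "(x, y) \<in> {(u, v). u \<in> S \<and> v \<in> S \<and> 0 < r u v}\<^sup>*" and "x \<in> S"
  shows "\<exists>t\<ge>0. 0 < pmf (P t x) y"
  using path
proof (induction rule: rtrancl_induct)
  case base
  then show ?case using ctmc_0[OF P \<open>x \<in> S\<close>] by (intro exI[of _ 0]) simp
next
  case (step y z)
  then obtain t where t: "0 \<le> t" "0 < pmf (P t x) y" by auto
  show ?case
  proof (cases "y = z")
    case False
    from step have yz: "y \<in> S" "z \<in> S" "0 < r y z" by auto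
    have "((\<lambda>h. (pmf (P h y) z - pmf (P 0 y) z) / (h - 0)) \<longlongrightarrow> r y z) (at 0 within {0..})"
      using ctmc_deriv[OF P yz(1,2)] False
      unfolding has_field_derivative_iff generator_def by simp
    from filterlim_compose[OF this filterlim_inverse_at_0_within[OF zero_less_one]]
    have "(\<lambda>n. real n * pmf (P (1 / real n) y) z) \<longlonglongrightarrow> r y z"
      using ctmc_0[OF P yz(1)] False by (simp add: mult.commute)
    then have "\<forall>\<^sub>F n in sequentially. 0 < real n * pmf (P (1 / real n) y) z"
      using yz(3) by (rule order_tendstoD)
    then obtain n :: nat where "0 < real n * pmf (P (1 / real n) y) z"
      by (metis (mono_tags, lifting) eventually_sequentially order_refl)
    then have "0 < pmf (P (1 / real n) y) z"
      by (simp add: zero_less_mult_iff)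
    then have "0 < pmf (P t x) y * pmf (P (1 / real n) y) z"
      using t by simp
    also have "\<dots> \<le> pmf (P (t + 1 / real n) x) z"
      by (rule ctmc_pmf_add_ge[OF P \<open>x \<in> S\<close>]) (use t in auto)
    finally show ?thesis using t by (intro exI[of _ "t + 1 / real n"]) simp
  qed (use t in auto)
qed

text \<open>
  If \<open>p \<noteq> q\<close>, each exceeds the other somewhere, say \<open>p\<close> at \<open>x0\<close> and \<open>q\<close> at \<open>x1\<close>. The
  pointwise minimum \<open>m\<close> is mapped by every kernel \<open>P t\<close> below both \<open>p\<close> and \<open>q\<close>, hence
  below \<open>m\<close>, and strictly so at \<open>x1\<close> once \<open>t\<close> is chosen such that the excess of \<open>p\<close> at
  \<open>x0\<close> reaches \<open>x1\<close>. This contradicts that kernels preserve total mass.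
\<close>

lemma stationary_for_unique:
  assumes reach: "\<And>x y. x \<in> S \<Longrightarrow> y \<in> S \<Longrightarrow> \<exists>t\<ge>0. 0 < pmf (P t x) y"
    and p: "stationary_for S P p" and q: "stationary_for S P q"
  shows "p = q"
proof (rule ccontr)
  assume "p \<noteq> q"
  then obtain x0 where x0: "pmf q x0 < pmf p x0"
    using pmf_eqI_le[of p q] by (meson not_le)
  from \<open>p \<noteq> q\<close> obtain x1 where x1: "pmf p x1 < pmf q x1"
    using pmf_eqI_le[of q p] by (metis not_le)
  have "x0 \<in> set_pmf p" using x0 pmf_nonneg[of q x0] by (metis not_le set_pmf_iff)
  moreover have "x1 \<in> set_pmf q" using x1 pmf_nonneg[of p x1] by (metis not_le set_pmf_iff)
  ultimately have "x0 \<in> S" "x1 \<in> S"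
    using p q by (auto simp: stationary_for_def)
  then obtain t where t: "0 \<le> t" "0 < pmf (P t x0) x1" using reach by blast
  define m where "m x = min (pmf p x) (pmf q x)" for x
  define M where "M y = (\<integral>\<^sup>+x. ennreal (m x) * ennreal (pmf (P t x) y) \<partial>count_space UNIV)" for y
  define e where "e = ennreal (pmf p x0 - m x0) * ennreal (pmf (P t x0) x1)"
  have m0: "0 \<le> m x" for x by (simp add: m_def)
  have st: "ennreal (pmf s y) = (\<integral>\<^sup>+x. ennreal (pmf s x) * ennreal (pmf (P t x) y) \<partial>count_space UNIV)"
    if "stationary_for S P s" for s y
  proof -
    have "bind_pmf s (P t) = s" using that t by (simp add: stationary_for_def)
    then show ?thesis using ennreal_pmf_bind[of s "P t" y] by (simp add: nn_integral_measure_pmf)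
  qed
  have Mp: "M y \<le> ennreal (pmf p y)" for y
    unfolding M_def by (subst st[OF p])
      (intro nn_integral_mono mult_right_mono ennreal_leI, auto simp: m_def)
  have Mq: "M y \<le> ennreal (pmf q y)" for y
    unfolding M_def by (subst st[OF q])
      (intro nn_integral_mono mult_right_mono ennreal_leI, auto simp: m_def)
  from Mp Mq have Mle: "M y \<le> ennreal (m y)" for y by (simp add: m_def min_def)
  have "M x1 + e = (\<integral>\<^sup>+x. ennreal (m x) * ennreal (pmf (P t x) x1) + e * indicator {x0} x \<partial>count_space UNIV)"
    unfolding M_def by (subst nn_integral_add) (auto simp: nn_integral_cmult_indicator)
  also have "\<dots> \<le> (\<integral>\<^sup>+x. ennreal (pmf p x) * ennreal (pmf (P t x) x1) \<partial>count_space UNIV)"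
  proof (rule nn_integral_mono)
    fix x
    have "ennreal (m x) * ennreal (pmf (P t x) x1) + e * indicator {x0} x
        \<le> ennreal (m x) * ennreal (pmf (P t x) x1) + ennreal (pmf p x - m x) * ennreal (pmf (P t x) x1)"
      by (intro add_left_mono) (auto simp: e_def indicator_def)
    also have "\<dots> = ennreal (pmf p x) * ennreal (pmf (P t x) x1)"
      using m0[of x] by (simp add: distrib_right[symmetric] ennreal_plus[symmetric] m_def
        del: ennreal_plus)
    finally show "ennreal (m x) * ennreal (pmf (P t x) x1) + e * indicator {x0} x
        \<le> ennreal (pmf p x) * ennreal (pmf (P t x) x1)" .
  qed
  also have "\<dots> = ennreal (m x1)" unfolding st[OF p, symmetric] using x1 by (simp add: m_def)
  finally have Mx1: "M x1 + e \<le> ennreal (m x1)" .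
  have "(\<integral>\<^sup>+y. M y \<partial>count_space UNIV) + e
      = (\<integral>\<^sup>+y. M y + e * indicator {x1} y \<partial>count_space UNIV)"
    by (subst nn_integral_add) (auto simp: nn_integral_cmult_indicator)
  also have "\<dots> \<le> (\<integral>\<^sup>+y. ennreal (m y) \<partial>count_space UNIV)"
    by (intro nn_integral_mono) (use Mle Mx1 in \<open>auto simp: indicator_def\<close>)
  also have "\<dots> = (\<integral>\<^sup>+x. ennreal (m x) * (\<integral>\<^sup>+y. ennreal (pmf (P t x) y) \<partial>count_space UNIV) \<partial>count_space UNIV)"
    by (simp add: nn_integral_pmf_eq_1)
  also have "\<dots> = (\<integral>\<^sup>+x. \<integral>\<^sup>+y. ennreal (m x) * ennreal (pmf (P t x) y) \<partial>count_space UNIV \<partial>count_space UNIV)"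
    by (simp add: nn_integral_cmult)
  also have "\<dots> = (\<integral>\<^sup>+y. M y \<partial>count_space UNIV)"
    unfolding M_def
    using nn_integral_fst_count_space[of "\<lambda>(x, y). ennreal (m x) * ennreal (pmf (P t x) y)"]
      nn_integral_snd_count_space[of "\<lambda>(x, y). ennreal (m x) * ennreal (pmf (P t x) y)"]
    by simp
  finally have *: "(\<integral>\<^sup>+y. M y \<partial>count_space UNIV) + e \<le> (\<integral>\<^sup>+y. M y \<partial>count_space UNIV)" .
  have "(\<integral>\<^sup>+y. M y \<partial>count_space UNIV) \<le> (\<integral>\<^sup>+y. ennreal (pmf p y) \<partial>count_space UNIV)"
    by (intro nn_integral_mono) (rule Mp)
  then have "(\<integral>\<^sup>+y. M y \<partial>count_space UNIV) \<noteq> \<top>"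
    by (auto simp: nn_integral_pmf_eq_1 top_unique)
  with * have "e = 0"
    using ennreal_add_left_cancel_le[of "\<integral>\<^sup>+y. M y \<partial>count_space UNIV" e 0] by auto
  moreover have "0 < e"
    using x0 t by (simp add: e_def m_def ennreal_zero_less_mult_iff)
  ultimately show False by simp
qed

section \<open>The gap Jackson network\<close>

lemma incr_decr: "0 < x i \<Longrightarrow> incr i (decr i x) = x"
  and decr_incr: "decr i (incr i x) = x"
  and incr_pos: "0 < incr i x i"
  by (simp_all add: incr_def decr_def)

lemma incr_in_states: "i \<in> {1..k} \<Longrightarrow> x \<in> states k \<Longrightarrow> incr i x \<in> states k"
  and decr_in_states: "i \<in> {1..k} \<Longrightarrow> x \<in> states k \<Longrightarrow> decr i x \<in> states k"
  by (auto simp: states_def incr_def decr_def PiE_iff extensional_def)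

definition transfer :: "nat \<Rightarrow> nat \<Rightarrow> (nat \<Rightarrow> nat) \<Rightarrow> (nat \<Rightarrow> nat) \<Rightarrow> bool" where
  "transfer i j x y \<longleftrightarrow> 0 < x i \<and> y = incr j (decr i x)"

definition departure :: "nat \<Rightarrow> (nat \<Rightarrow> nat) \<Rightarrow> (nat \<Rightarrow> nat) \<Rightarrow> bool" where
  "departure i x y \<longleftrightarrow> 0 < x i \<and> y = decr i x"

lemma transfer_sym: "transfer i j x y \<longleftrightarrow> transfer j i y x"
  by (auto simp: transfer_def incr_decr decr_incr incr_pos)

text \<open>
  Arrivals are thereby treated as reversed departures, which makes the pairing of
  each event with its reversal visible in the rates.
\<close>

lemma arrival_iff_departure: "y = incr i x \<longleftrightarrow> departure i y x"
  by (auto simp: departure_def incr_decr decr_incr incr_pos)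

lemma departure_target_unique: "departure i x z \<Longrightarrow> departure i x z' \<Longrightarrow> z = z'"
  and transfer_target_unique: "transfer i j x z \<Longrightarrow> transfer i j x z' \<Longrightarrow> z = z'"
  by (simp_all add: departure_def transfer_def)

lemma departure_source_unique: "departure i z x \<Longrightarrow> departure i z' x \<Longrightarrow> z = z'"
  by (simp add: arrival_iff_departure[symmetric])

text \<open>
  Each product of service rate and routing probability collapses to a single
  parameter. The test function \<open>g\<close> serves two purposes: with an indicator of the
  transfer it gives the internal jumps, and with the constant \<open>1\<close> it shows that
  customers leave the network from queue \<open>k\<close> only.
\<close>

lemma sum_gap_routing:
  assumes "1 \<le> k" "i \<in> {1..k}" "\<And>i. i \<in> {1..k} \<Longrightarrow> 0 < lam i" "\<And>i. i \<in> {1..k} \<Longrightarrow> 0 < mu i"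
  shows "(\<Sum>j=1..k. gap_service lam mu i * gap_routing k lam mu i j * g j)
       = (if 2 \<le> i then lam (i - 1) * g (i - 1) else 0) + (if i < k then mu i * g (i + 1) else 0)"
proof -
  have pos: "2 \<le> i \<Longrightarrow> lam (i - 1) + mu i > 0"
    using assms(2) by (intro add_pos_pos assms(3,4)) auto
  have "(\<Sum>j=1..k. gap_service lam mu i * gap_routing k lam mu i j * g j)
     = (\<Sum>j=1..k. (if j = i - 1 \<and> 2 \<le> i then lam (i - 1) * g (i - 1) else 0)
          + (if j = i + 1 \<and> i < k then mu i * g (i + 1) else 0))"
    by (rule sum.cong) (use pos assms(2) in \<open>auto simp: gap_service_def gap_routing_def\<close>)
  also have "\<dots> = (if 2 \<le> i then lam (i - 1) * g (i - 1) else 0) + (if i < k then mu i * g (i + 1) else 0)"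
    unfolding sum.distrib using assms(2) by (auto simp: sum.delta)
  finally show ?thesis .
qed

text \<open>
  In this form, neighbouring queues \<open>i\<close> and \<open>i + 1\<close> exchange customers at rates \<open>mu i\<close>
  and \<open>lam i\<close>, and queue \<open>k\<close> exchanges customers with the outside at rates \<open>mu k\<close> and
  \<open>lam k\<close>: each event stands next to its reversal.
\<close>

definition gap_rate :: "nat \<Rightarrow> (nat \<Rightarrow> real) \<Rightarrow> (nat \<Rightarrow> real) \<Rightarrow> (nat \<Rightarrow> nat) \<Rightarrow> (nat \<Rightarrow> nat) \<Rightarrow> real" where
  "gap_rate k lam mu x y =
     lam k * of_bool (departure k y x) + mu k * of_bool (departure k x y)
     + (\<Sum>i=1..<k. mu i * of_bool (transfer i (i + 1) x y) + lam i * of_bool (transfer (i + 1) i x y))"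

lemma gap_jackson_rate_eq:
  assumes "1 \<le> k" "\<And>i. i \<in> {1..k} \<Longrightarrow> 0 < lam i" "\<And>i. i \<in> {1..k} \<Longrightarrow> 0 < mu i"
  shows "gap_jackson_rate k lam mu x y = gap_rate k lam mu x y"
proof -
  let ?s = "gap_service lam mu" and ?R = "gap_routing k lam mu"
  note routing = sum_gap_routing[OF assms(1), where lam = lam and mu = mu, OF _ assms(2,3)]
  have arr: "(\<Sum>i=1..k. if y = incr i x then gap_arrival k lam i else 0)
      = lam k * of_bool (departure k y x)"
  proof -
    have "(\<Sum>i=1..k. if y = incr i x then gap_arrival k lam i else 0)
      = (\<Sum>i=1..k. if i = k then lam k * of_bool (departure k y x) else 0)"
      by (rule sum.cong) (auto simp: gap_arrival_def arrival_iff_departure)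
    then show ?thesis using assms(1) by simp
  qed
  have dep: "(\<Sum>i=1..k. if x i > 0 \<and> y = decr i x then ?s i * (1 - (\<Sum>j=1..k. ?R i j)) else 0)
      = mu k * of_bool (departure k x y)"
  proof -
    have "?s i * (1 - (\<Sum>j=1..k. ?R i j)) = (if i = k then mu k else 0)" if "i \<in> {1..k}" for i
    proof -
      have "?s i * (1 - (\<Sum>j=1..k. ?R i j)) = ?s i - (\<Sum>j=1..k. ?s i * ?R i j * 1)"
        by (simp add: right_diff_distrib sum_distrib_left)
      also have "\<dots> = (if i = k then mu k else 0)"
        using that routing[OF that, of "\<lambda>_. 1"] by (auto simp: gap_service_def)
      finally show ?thesis .
    qed
    then have "(\<Sum>i=1..k. if x i > 0 \<and> y = decr i x then ?s i * (1 - (\<Sum>j=1..k. ?R i j)) else 0)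
      = (\<Sum>i=1..k. if i = k then mu k * of_bool (departure k x y) else 0)"
      by (intro sum.cong) (auto simp: departure_def)
    then show ?thesis using assms(1) by simp
  qed
  have tr: "(\<Sum>i=1..k. \<Sum>j=1..k. if x i > 0 \<and> y = incr j (decr i x) then ?s i * ?R i j else 0)
      = (\<Sum>i=1..<k. mu i * of_bool (transfer i (i + 1) x y) + lam i * of_bool (transfer (i + 1) i x y))"
  proof -
    have "(\<Sum>i=1..k. \<Sum>j=1..k. if x i > 0 \<and> y = incr j (decr i x) then ?s i * ?R i j else 0)
       = (\<Sum>i=1..k. \<Sum>j=1..k. ?s i * ?R i j * of_bool (transfer i j x y))"
      by (intro sum.cong refl) (auto simp: transfer_def)
    also have "\<dots> = (\<Sum>i=1..k. (if 2 \<le> i then lam (i - 1) * of_bool (transfer i (i - 1) x y) else 0)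
        + (if i < k then mu i * of_bool (transfer i (i + 1) x y) else 0))"
      by (intro sum.cong refl routing)
    moreover have "(\<Sum>i=1..k. if i < k then mu i * of_bool (transfer i (i + 1) x y) else 0)
       = (\<Sum>i=1..<k. mu i * of_bool (transfer i (i + 1) x y))"
      by (rule sum.mono_neutral_cong_right) auto
    moreover have "(\<Sum>i=1..k. if 2 \<le> i then lam (i - 1) * of_bool (transfer i (i - 1) x y) else 0)
       = (\<Sum>i=1..<k. lam i * of_bool (transfer (i + 1) i x y))"
    proof -
      have "(\<Sum>i=1..k. if 2 \<le> i then lam (i - 1) * of_bool (transfer i (i - 1) x y) else 0)
         = (\<Sum>i\<in>Suc ` {1..<k}. lam (i - 1) * of_bool (transfer i (i - 1) x y))"
        by (rule sum.mono_neutral_cong_right) (auto simp: image_Suc_atLeastLessThan)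
      then show ?thesis by (subst (asm) sum.reindex) (auto simp: o_def)
    qed
    ultimately show ?thesis
      by (simp only: sum.distrib add.commute)
  qed
  show ?thesis
    unfolding gap_jackson_rate_def jackson_rate_def gap_rate_def arr dep tr by simp
qed

text \<open>
  The weight that the product of geometric laws with ratios \<open>\<rho> i\<close> gives to \<open>x\<close>.
\<close>

definition product_weight :: "nat \<Rightarrow> (nat \<Rightarrow> real) \<Rightarrow> (nat \<Rightarrow> nat) \<Rightarrow> real" where
  "product_weight k \<rho> x = (\<Prod>i=1..k. (1 - \<rho> i) * \<rho> i ^ x i)"

lemma product_weight_incr:
  assumes "i \<in> {1..k}"
  shows "product_weight k \<rho> (incr i x) = \<rho> i * product_weight k \<rho> x"
proof -
  have "product_weight k \<rho> (incr i x) = (\<Prod>j=1..k. (if j = i then \<rho> i else 1) * ((1 - \<rho> j) * \<rho> j ^ x j))"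
    unfolding product_weight_def by (rule prod.cong) (auto simp: incr_def)
  then show ?thesis
    using assms by (simp add: prod.distrib product_weight_def)
qed

lemma product_weight_decr:
  assumes "i \<in> {1..k}" "0 < x i"
  shows "product_weight k \<rho> x = \<rho> i * product_weight k \<rho> (decr i x)"
  using product_weight_incr[OF assms(1), of \<rho> "decr i x"] assms(2) by (simp add: incr_decr)

text \<open>
  The network is a line closed off at queue \<open>1\<close>, so in equilibrium the flow through
  each cut of the line vanishes. This is why the traffic equations take the two-term
  form of the hypotheses, and why the product form is reversible, which fails for
  general Jackson networks. Moving a customer from \<open>i\<close> to \<open>i + 1\<close> multiplies the
  weight by \<open>\<rho> (i + 1) / \<rho> i\<close>, exactly the ratio of the two opposite rates.
\<close>

lemma gap_rate_detailed_balance: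
  assumes "1 \<le> k"
    and last: "\<rho> k * mu k = lam k"
    and cut: "\<And>i. i \<in> {1..<k} \<Longrightarrow> \<rho> i * mu i = \<rho> (i + 1) * lam i"
  shows "product_weight k \<rho> x * gap_rate k lam mu x y = product_weight k \<rho> y * gap_rate k lam mu y x"
proof -
  let ?w = "product_weight k \<rho>"
  have dep: "?w u * (mu k * of_bool (departure k u v)) = ?w v * (lam k * of_bool (departure k u v))" for u v
  proof (cases "departure k u v")
    case True
    then have "?w u = \<rho> k * ?w v"
      using product_weight_decr[of k k u \<rho>] assms(1) by (simp add: departure_def)
    with last show ?thesis by (simp add: mult_ac)
  qed simp
  have tr: "?w u * (mu i * of_bool (transfer i (i + 1) u v)) = ?w v * (lam i * of_bool (transfer (i + 1) i v u))"
    if i: "i \<in> {1..<k}" for i u v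
  proof (cases "transfer i (i + 1) u v")
    case True
    then have "?w u = \<rho> i * ?w (decr i u)" "?w v = \<rho> (i + 1) * ?w (decr i u)"
      using i product_weight_decr[of i k u \<rho>] product_weight_incr[of "i + 1" k \<rho> "decr i u"]
      by (auto simp: transfer_def)
    with cut[OF i] True transfer_sym[of i "i + 1" u v] show ?thesis by (simp add: mult_ac)
  qed (use transfer_sym[of i "i + 1" u v] in simp)
  have "(\<Sum>i=1..<k. ?w x * (mu i * of_bool (transfer i (i + 1) x y)) + ?w x * (lam i * of_bool (transfer (i + 1) i x y)))
     = (\<Sum>i=1..<k. ?w y * (mu i * of_bool (transfer i (i + 1) y x)) + ?w y * (lam i * of_bool (transfer (i + 1) i y x)))"
    by (rule sum.cong[OF refl]) (simp only: tr add.commute)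
  then show ?thesis
    unfolding gap_rate_def distrib_left sum_distrib_left
    using dep[of x y] dep[of y x] by simp
qed

lemma gap_rate_bounded:
  assumes "\<And>i. i \<in> {1..k} \<Longrightarrow> 0 \<le> lam i" "\<And>i. i \<in> {1..k} \<Longrightarrow> 0 \<le> mu i" "1 \<le> k"
  shows "finite {z. gap_rate k lam mu x z \<noteq> 0}"
    and "(\<Sum>\<^sub>\<infinity>z\<in>S. gap_rate k lam mu x z) \<le> (\<Sum>i=1..k. lam i + mu i)"
proof -
  let ?F = "{z. gap_rate k lam mu x z \<noteq> 0}"
  have "?F \<subseteq> {incr k x, decr k x} \<union> (\<lambda>i. incr (i + 1) (decr i x)) ` {1..<k} \<union> (\<lambda>i. incr i (decr (i + 1) x)) ` {1..<k}"
  proof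
    fix z assume "z \<in> ?F"
    then have "departure k z x \<or> departure k x z
       \<or> (\<exists>i\<in>{1..<k}. transfer i (i + 1) x z \<or> transfer (i + 1) i x z)"
      by (rule contrapos_pp) (simp add: gap_rate_def)
    then show "z \<in> {incr k x, decr k x} \<union> (\<lambda>i. incr (i + 1) (decr i x)) ` {1..<k} \<union> (\<lambda>i. incr i (decr (i + 1) x)) ` {1..<k}"
      unfolding transfer_def departure_def[of k x z] arrival_iff_departure[of z k x, symmetric]
      by blast
  qed
  then show fin: "finite ?F" by (rule finite_subset) simp
  have unique: "(\<Sum>z\<in>A. c * of_bool (R z)) \<le> c"
    if "finite A" "0 \<le> c" "\<And>z z'. R z \<Longrightarrow> R z' \<Longrightarrow> z = z'"
    for A :: "(nat \<Rightarrow> nat) set" and c :: real and R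
  proof -
    have "card (A \<inter> {z. R z}) \<le> 1"
      using that by (auto simp: card_le_Suc0_iff_eq)
    moreover have "(\<Sum>z\<in>A. c * of_bool (R z)) = c * real (card (A \<inter> {z. R z}))"
      using that(1) by (simp add: sum_distrib_left[symmetric] of_bool_def sum.If_cases)
    ultimately show ?thesis
      using that(2) by (simp add: mult_left_le)
  qed
  define G where "G = S \<inter> ?F"
  have G: "finite G" using fin by (simp add: G_def)
  have "(\<Sum>\<^sub>\<infinity>z\<in>S. gap_rate k lam mu x z) = (\<Sum>\<^sub>\<infinity>z\<in>G. gap_rate k lam mu x z)"
    by (rule infsum_cong_neutral) (auto simp: G_def)
  also have "\<dots> = (\<Sum>z\<in>G. gap_rate k lam mu x z)"
    using G by simp
  also have "\<dots> = (\<Sum>z\<in>G. lam k * of_bool (departure k z x)) + (\<Sum>z\<in>G. mu k * of_bool (departure k x z))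
     + (\<Sum>i=1..<k. (\<Sum>z\<in>G. mu i * of_bool (transfer i (i + 1) x z))
                 + (\<Sum>z\<in>G. lam i * of_bool (transfer (i + 1) i x z)))"
    unfolding gap_rate_def sum.distrib by (simp only: sum.swap[of _ "{1..<k}" G])
  also have "\<dots> \<le> lam k + mu k + (\<Sum>i=1..<k. mu i + lam i)"
    by (intro add_mono sum_mono unique G)
       (use assms in \<open>simp_all add: departure_target_unique departure_source_unique transfer_target_unique\<close>)
  also have "\<dots> = (\<Sum>i=1..k. lam i + mu i)"
    using assms(3) by (simp add: atLeastLessThanSuc_atLeastAtMost[symmetric] add.commute)
  finally show "(\<Sum>\<^sub>\<infinity>z\<in>S. gap_rate k lam mu x z) \<le> (\<Sum>i=1..k. lam i + mu i)" .
qed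

lemma gap_rate_pos:
  assumes "\<And>i. i \<in> {1..k} \<Longrightarrow> 0 < lam i" "\<And>i. i \<in> {1..k} \<Longrightarrow> 0 < mu i" "1 \<le> k"
    and "departure k x y \<or> (\<exists>i\<in>{1..<k}. transfer i (i + 1) x y)"
  shows "0 < gap_rate k lam mu x y"
proof -
  have pos: "0 < lam k" "0 < mu k" using assms by auto
  have nonneg: "0 \<le> mu i * of_bool (transfer i (i + 1) x y) + lam i * of_bool (transfer (i + 1) i x y)"
    if "i \<in> {1..<k}" for i
    using assms(1,2)[of i] that by (simp add: of_bool_def)
  show ?thesis
  proof (cases "departure k x y")
    case True
    then have "0 < lam k * of_bool (departure k y x) + mu k * of_bool (departure k x y)"
      using pos by (simp add: of_bool_def)
    then show ?thesis
      unfolding gap_rate_def by (rule add_pos_nonneg) (rule sum_nonneg, rule nonneg)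
  next
    case False
    then obtain i where i: "i \<in> {1..<k}" "transfer i (i + 1) x y" using assms(4) by auto
    have "0 < (\<Sum>i=1..<k. mu i * of_bool (transfer i (i + 1) x y) + lam i * of_bool (transfer (i + 1) i x y))"
      by (rule sum_pos2[OF _ i(1)]) (use i assms(1,2)[of i] nonneg in \<open>auto simp: of_bool_def\<close>)
    then show ?thesis
      unfolding gap_rate_def using pos by (intro add_nonneg_pos) auto
  qed
qed

text \<open>
  Customers can always move towards queue \<open>k\<close> and then out. The induction measure
  counts the moves that are still needed: a customer in queue \<open>i\<close> needs \<open>k + 1 - i\<close>.
\<close>

lemma gap_rate_reaches_empty:
  assumes "\<And>i. i \<in> {1..k} \<Longrightarrow> 0 < lam i" "\<And>i. i \<in> {1..k} \<Longrightarrow> 0 < mu i" "1 \<le> k"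
    and "x \<in> states k"
  shows "(x, \<lambda>i\<in>{1..k}. 0) \<in> {(u, v). u \<in> states k \<and> v \<in> states k \<and> 0 < gap_rate k lam mu u v}\<^sup>*"
  using assms(4)
proof (induction "\<Sum>i=1..k. x i * (k + 1 - i)" arbitrary: x rule: less_induct)
  case less
  let ?E = "{(u, v). u \<in> states k \<and> v \<in> states k \<and> 0 < gap_rate k lam mu u v}"
  show ?case
  proof (cases "\<forall>i\<in>{1..k}. x i = 0")
    case True
    then have "x = (\<lambda>i\<in>{1..k}. 0)"
      using less.prems by (auto simp: states_def PiE_iff extensional_def fun_eq_iff)
    then show ?thesis by simp
  next
    case False
    then obtain i where i: "i \<in> {1..k}" "0 < x i" by auto
    define y where "y = (if i = k then decr k x else incr (i + 1) (decr i x))"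
    have y: "y \<in> states k"
      using i less.prems unfolding y_def by (auto intro!: incr_in_states decr_in_states)
    have "departure k x y \<or> (\<exists>i\<in>{1..<k}. transfer i (i + 1) x y)"
      using i by (cases "i = k") (auto simp: y_def departure_def transfer_def)
    with gap_rate_pos[OF assms(1-3)] have "(x, y) \<in> ?E"
      using y less.prems by auto
    moreover have "(\<Sum>i=1..k. y i * (k + 1 - i)) < (\<Sum>i=1..k. x i * (k + 1 - i))"
    proof -
      have x: "(\<Sum>j=1..k. x j * (k + 1 - j)) = (\<Sum>j=1..k. decr i x j * (k + 1 - j)) + (k + 1 - i)"
      proof -
        have "(\<Sum>j=1..k. x j * (k + 1 - j)) = (\<Sum>j=1..k. decr i x j * (k + 1 - j) + (if j = i then k + 1 - i else 0))"
          using i by (intro sum.cong) (auto simp: decr_def gr0_conv_Suc)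
        then show ?thesis using i by (simp add: sum.distrib)
      qed
      have inc: "(\<Sum>j=1..k. incr l z j * (k + 1 - j)) = (\<Sum>j=1..k. z j * (k + 1 - j)) + (k + 1 - l)"
        if "l \<in> {1..k}" for l z
      proof -
        have "(\<Sum>j=1..k. incr l z j * (k + 1 - j)) = (\<Sum>j=1..k. z j * (k + 1 - j) + (if j = l then k + 1 - l else 0))"
          by (intro sum.cong) (auto simp: incr_def distrib_right)
        then show ?thesis using that by (simp add: sum.distrib)
      qed
      show ?thesis
        using i x inc[of "i + 1" "decr i x"] by (auto simp: y_def)
    qed
    ultimately show ?thesis
      using less.hyps[OF _ y] by (meson converse_rtrancl_into_rtrancl)
  qed
qed

text \<open>
  Detailed balance with a positive weight makes positivity of the rates symmetric, so
  a path to the empty network can be traversed backwards.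
\<close>

lemma gap_rate_irreducible:
  assumes pos: "\<And>i. i \<in> {1..k} \<Longrightarrow> 0 < lam i" "\<And>i. i \<in> {1..k} \<Longrightarrow> 0 < mu i" "1 \<le> k"
    and bal: "\<rho> k * mu k = lam k" "\<And>i. i \<in> {1..<k} \<Longrightarrow> \<rho> i * mu i = \<rho> (i + 1) * lam i"
    and \<rho>: "\<And>i. i \<in> {1..k} \<Longrightarrow> 0 < \<rho> i \<and> \<rho> i < 1"
    and "x \<in> states k" "y \<in> states k"
  shows "(x, y) \<in> {(u, v). u \<in> states k \<and> v \<in> states k \<and> 0 < gap_rate k lam mu u v}\<^sup>*" (is "_ \<in> ?E\<^sup>*")
proof -
  have w: "0 < product_weight k \<rho> z" for z
    unfolding product_weight_def using \<rho> by (intro prod_pos) auto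
  have "0 < gap_rate k lam mu v u" if "0 < gap_rate k lam mu u v" for u v
  proof -
    have "0 < product_weight k \<rho> v * gap_rate k lam mu v u"
      using gap_rate_detailed_balance[where \<rho>=\<rho>, OF pos(3) bal, of u v] w[of u] that
      by (metis mult_pos_pos)
    then show ?thesis using w[of v] by (simp add: zero_less_mult_iff)
  qed
  then have "sym ?E" by (auto intro!: symI)
  then have "sym (?E\<^sup>*)" by (rule sym_rtrancl)
  then have "(\<lambda>i\<in>{1..k}. 0, y) \<in> ?E\<^sup>*"
    using gap_rate_reaches_empty[OF pos \<open>y \<in> states k\<close>] by (rule symD)
  with gap_rate_reaches_empty[OF pos \<open>x \<in> states k\<close>] show ?thesis by (rule rtrancl_trans)
qed

text \<open>
  The load solves the cut equations of the line: entering at queue \<open>k\<close> with ratio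
  \<open>lam k / mu k\<close>, each step towards queue \<open>1\<close> contributes one more factor.
\<close>

definition gap_load :: "nat \<Rightarrow> (nat \<Rightarrow> real) \<Rightarrow> (nat \<Rightarrow> real) \<Rightarrow> nat \<Rightarrow> real" where
  "gap_load k lam mu i = (\<Prod>j=i..k. lam j / mu j)"

lemma gap_load_balance:
  assumes "\<And>i. i \<in> {1..k} \<Longrightarrow> 0 < mu i" "1 \<le> k"
  shows "gap_load k lam mu k * mu k = lam k"
    and "i \<in> {1..<k} \<Longrightarrow> gap_load k lam mu i * mu i = gap_load k lam mu (i + 1) * lam i"
proof -
  show "gap_load k lam mu k * mu k = lam k"
    using assms(1)[of k] assms(2) by (simp add: gap_load_def)
  assume i: "i \<in> {1..<k}"
  then have "gap_load k lam mu i = lam i / mu i * gap_load k lam mu (i + 1)"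
    by (simp add: gap_load_def prod.atLeast_Suc_atMost)
  then show "gap_load k lam mu i * mu i = gap_load k lam mu (i + 1) * lam i"
    using assms(1)[of i] i by simp
qed

text \<open>
  The default value \<^const>\<open>undefined\<close> makes the samples extensional, as the encoding of
  \<open>k\<close>-tuples in \<^const>\<open>states\<close> demands.
\<close>

definition geometric_product :: "nat \<Rightarrow> (nat \<Rightarrow> real) \<Rightarrow> (nat \<Rightarrow> nat) pmf" where
  "geometric_product k \<rho> = Pi_pmf {1..k} undefined (\<lambda>i. geometric_pmf (1 - \<rho> i))"

lemma geometric_product:
  assumes \<rho>: "\<And>i. i \<in> {1..k} \<Longrightarrow> 0 < \<rho> i \<and> \<rho> i < 1"
  shows set_geometric_product: "set_pmf (geometric_product k \<rho>) \<subseteq> states k"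
    and pmf_geometric_product: "x \<in> states k \<Longrightarrow> pmf (geometric_product k \<rho>) x = product_weight k \<rho> x"
proof -
  show "set_pmf (geometric_product k \<rho>) \<subseteq> states k"
    unfolding geometric_product_def states_def PiE_def
    by (rule order_trans[OF set_Pi_pmf_subset]) (auto simp: extensional_def)
  assume "x \<in> states k"
  then have "pmf (geometric_product k \<rho>) x = (\<Prod>i=1..k. pmf (geometric_pmf (1 - \<rho> i)) (x i))"
    unfolding geometric_product_def by (intro pmf_Pi') (auto simp: states_def)
  also have "\<dots> = product_weight k \<rho> x"
    unfolding product_weight_def using \<rho> by (intro prod.cong) (auto simp: less_imp_le)
  finally show "pmf (geometric_product k \<rho>) x = product_weight k \<rho> x" .
qed

lemma gap_jackson_stationary_iff:
  assumes pos: "\<And>i. i \<in> {1..k} \<Longrightarrow> 0 < lam i" "\<And>i. i \<in> {1..k} \<Longrightarrow> 0 < mu i" "1 \<le> k"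
    and load: "\<And>i. i \<in> {1..k} \<Longrightarrow> gap_load k lam mu i < 1"
    and P: "ctmc (states k) (gap_jackson_rate k lam mu) P"
  shows "stationary_for (states k) P p \<longleftrightarrow> p = geometric_product k (gap_load k lam mu)"
proof -
  let ?\<rho> = "gap_load k lam mu"
  let ?G = "geometric_product k ?\<rho>"
  have \<rho>: "0 < ?\<rho> i \<and> ?\<rho> i < 1" if "i \<in> {1..k}" for i
    using load[OF that] pos that unfolding gap_load_def by (auto intro!: prod_pos)
  have "gap_jackson_rate k lam mu = gap_rate k lam mu"
    by (intro ext gap_jackson_rate_eq pos)
  with P have P: "ctmc (states k) (gap_rate k lam mu) P" by simp
  note balance = gap_load_balance[where lam = lam, OF pos(2,3)]
  have nonneg: "0 \<le> lam i" "0 \<le> mu i" if "i \<in> {1..k}" for i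
    using pos(1,2)[OF that] by auto
  note bounded = gap_rate_bounded[where lam = lam and mu = mu, OF nonneg pos(3)]
  have G: "stationary_for (states k) P ?G"
  proof (rule reversible_stationary[OF P, where C = "(\<Sum>i=1..k. lam i + mu i) + 1"])
    show "set_pmf ?G \<subseteq> states k" by (rule set_geometric_product[OF \<rho>])
    show "pmf ?G x * gap_rate k lam mu x y = pmf ?G y * gap_rate k lam mu y x"
      if "x \<in> states k" "y \<in> states k" for x y
      using that \<rho> by (simp only: pmf_geometric_product)
        (rule gap_rate_detailed_balance[OF pos(3) balance])
    show "finite {z \<in> states k - {x}. gap_rate k lam mu x z \<noteq> 0}" for x
      by (rule finite_subset[OF _ bounded(1)[of x]]) auto
    show "(\<Sum>\<^sub>\<infinity>z\<in>states k - {x}. gap_rate k lam mu x z) < (\<Sum>i=1..k. lam i + mu i) + 1" for x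
      using bounded(2)[where x = x and S = "states k - {x}"] by simp
    show "0 \<le> (\<Sum>i=1..k. lam i + mu i) + 1"
      using nonneg by (intro add_nonneg_nonneg sum_nonneg) auto
  qed
  have "\<exists>t\<ge>0. 0 < pmf (P t x) y" if "x \<in> states k" "y \<in> states k" for x y
    by (rule ctmc_reaches[OF P gap_rate_irreducible[OF pos balance \<rho> that] that(1)])
  then have "p = ?G" if "stationary_for (states k) P p"
    using stationary_for_unique that G by blast
  with G show ?thesis by blast
qed


section \<open>Scaled geometric laws and exponential limits\<close>

lemma emeasure_exponential_ge:
  assumes "0 < l" "0 \<le> a"
  shows "emeasure (density lborel (exponential_density l)) {a..} = ennreal (exp (- a * l))"
proof -
  let ?M = "density lborel (exponential_density l)"
  interpret prob_space ?M by (rule prob_space_exponential_density[OF assms(1)])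
  have "distributed ?M lborel (\<lambda>x. x) (exponential_density l)"
    unfolding distributed_def
    by (auto simp: distr_id2)
  from exponential_distributedD_gt[OF this assms(2,1)]
  have "emeasure ?M {a<..} = ennreal (exp (- a * l))"
    by (simp add: emeasure_eq_measure greaterThan_def)
  moreover have "emeasure ?M {a..} = emeasure ?M {a<..}"
  proof (rule emeasure_eq_AE)
    have "AE x in lborel. x \<noteq> a" by (rule AE_lborel_singleton)
    then show "AE x in ?M. (x \<in> {a..}) = (x \<in> {a<..})"
      by (subst AE_density) auto
  qed auto
  ultimately show ?thesis by simp
qed

lemma emeasure_exponential_half_open:
  assumes "0 < l" "0 \<le> a" "a \<le> b"
  shows "emeasure (density lborel (exponential_density l)) {a..<b} = ennreal (exp (- a * l) - exp (- b * l))"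
proof -
  have "{a..<b} = {a..} - {b..}" by auto
  then show ?thesis
    using assms emeasure_exponential_ge[of l]
    by (simp add: emeasure_Diff ennreal_minus)
qed

lemma exponential_AE_nonneg:
  "AE x in density lborel (exponential_density l). 0 \<le> x"
  by (subst AE_density) (auto simp: exponential_density_def)

text \<open>
  Lumping an exponential variable into cells of length \<open>s\<close> gives a geometric law
  because the tail \<open>exp (- l * s * m)\<close> is a power of \<open>exp (- l * s)\<close>; the given \<open>s\<close>
  makes this ratio equal to \<open>\<rho>\<close>. The integer-valued floor, rather than a
  natural-valued one, keeps the rescaled map convergent at every real point, so that
  null sets of the product measure need no attention later.
\<close>

lemma geometric_eq_floor_exponential:
  assumes "0 < l" "0 < \<rho>" "\<rho> < 1"
  defines "s \<equiv> - ln \<rho> / l"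
  shows "distr (density lborel (exponential_density l)) (count_space UNIV) (\<lambda>x. \<lfloor>x / s\<rfloor>)
       = distr (geometric_pmf (1 - \<rho>)) (count_space UNIV) int"
proof (rule measure_eqI_countable[of _ UNIV])
  let ?M = "density lborel (exponential_density l)"
  have s: "0 < s" unfolding s_def using assms(1-3) by (intro divide_pos_pos) auto
  have sl: "s * l = - ln \<rho>" using assms by (simp add: s_def)
  fix m :: int
  have floor: "\<lfloor>x / s\<rfloor> = m \<longleftrightarrow> real_of_int m * s \<le> x \<and> x < (real_of_int m + 1) * s" for x
    using s by (simp add: floor_eq_iff pos_le_divide_eq pos_divide_less_eq)
  have "emeasure (distr ?M (count_space UNIV) (\<lambda>x. \<lfloor>x / s\<rfloor>)) {m}
      = emeasure ?M {real_of_int m * s..<(real_of_int m + 1) * s}"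
    by (subst emeasure_distr) (simp_all add: vimage_def floor atLeastLessThan_def atLeast_def lessThan_def Collect_conj_eq)
  also have "\<dots> = emeasure (distr (geometric_pmf (1 - \<rho>)) (count_space UNIV) int) {m}"
  proof (cases "0 \<le> m")
    case True
    then obtain n where m: "m = int n" by (metis nonneg_int_cases)
    have pow: "exp (- (real j * s) * l) = \<rho> ^ j" for j
    proof -
      have "- (real j * s) * l = real j * ln \<rho>" using sl by (simp add: mult.assoc)
      then show ?thesis using assms by (simp add: exp_of_nat_mult)
    qed
    have "emeasure ?M {real n * s..<real (Suc n) * s} = ennreal (\<rho> ^ n - \<rho> ^ Suc n)"
      using emeasure_exponential_half_open[of l "real n * s" "real (Suc n) * s"] s \<open>0 < l\<close>
      unfolding pow by (simp add: mult_right_mono del: power_Suc of_nat_Suc)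
    also have "\<rho> ^ n - \<rho> ^ Suc n = pmf (geometric_pmf (1 - \<rho>)) n"
      using assms by (simp add: algebra_simps)
    also have "ennreal (pmf (geometric_pmf (1 - \<rho>)) n) = emeasure (distr (geometric_pmf (1 - \<rho>)) (count_space UNIV) int) {m}"
      by (subst emeasure_distr) (auto simp: m emeasure_pmf_single[symmetric] intro!: arg_cong[where f="emeasure _"])
    finally show ?thesis using m by (simp add: add.commute)
  next
    case False
    have "(real_of_int m + 1) * s \<le> 0" using False s by (simp add: mult_le_0_iff)
    then have "emeasure ?M {real_of_int m * s..<(real_of_int m + 1) * s} = emeasure ?M {}"
      by (intro emeasure_eq_AE AE_mp[OF exponential_AE_nonneg AE_I2]) auto
    moreover have "int -` {m} = {}" using False by auto
    ultimately show ?thesis by (subst emeasure_distr) auto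
  qed
  finally show "emeasure (distr ?M (count_space UNIV) (\<lambda>x. \<lfloor>x / s\<rfloor>)) {m}
      = emeasure (distr (geometric_pmf (1 - \<rho>)) (count_space UNIV) int) {m}" .
qed auto

lemma distr_geometric_eq_distr_exponential:
  assumes "0 < l" "0 < \<rho>" "\<rho> < 1"
  shows "distr (geometric_pmf (1 - \<rho>)) borel (\<lambda>m. real m / c)
       = distr (density lborel (exponential_density l)) borel (\<lambda>x. real_of_int \<lfloor>x / (- ln \<rho> / l)\<rfloor> / c)"
proof -
  have "distr (geometric_pmf (1 - \<rho>)) borel (\<lambda>m. real m / c)
      = distr (distr (geometric_pmf (1 - \<rho>)) (count_space UNIV) int) borel (\<lambda>m. real_of_int m / c)"
    by (subst distr_distr) (auto simp: o_def)
  also have "\<dots> = distr (density lborel (exponential_density l)) borel (\<lambda>x. real_of_int \<lfloor>x / (- ln \<rho> / l)\<rfloor> / c)"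
    unfolding geometric_eq_floor_exponential[OF assms, symmetric]
    by (subst distr_distr) (auto simp: o_def)
  finally show ?thesis .
qed

lemma distr_PiM_components:
  assumes fin: "finite I" and prob: "\<And>i. prob_space (E i)"
    and g: "\<And>i. g i \<in> E i \<rightarrow>\<^sub>M M"
  shows "distr (Pi\<^sub>M I E) (\<Pi>\<^sub>M i\<in>I. M) (\<lambda>x. \<lambda>i\<in>I. g i (x i)) = (\<Pi>\<^sub>M i\<in>I. distr (E i) M (g i))"
    (is "distr _ ?B ?\<Phi> = _")
proof -
  define N where "N i = distr (E i) M (g i)" for i
  interpret E: product_prob_space E by (intro product_prob_spaceI prob)
  interpret N: product_prob_space N
    unfolding N_def by (intro product_prob_spaceI prob_space.prob_space_distr prob g)
  have \<Phi>: "?\<Phi> \<in> Pi\<^sub>M I E \<rightarrow>\<^sub>M ?B"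
  proof (rule measurable_restrict)
    fix i assume "i \<in> I"
    then have "(\<lambda>x. x i) \<in> Pi\<^sub>M I E \<rightarrow>\<^sub>M E i" by (rule measurable_component_singleton)
    from measurable_compose[OF this g]
    show "(\<lambda>x. g i (x i)) \<in> Pi\<^sub>M I E \<rightarrow>\<^sub>M M" .
  qed
  have "distr (Pi\<^sub>M I E) ?B ?\<Phi> = Pi\<^sub>M I N"
  proof (rule N.PiM_eqI[OF fin])
    show "sets (distr (Pi\<^sub>M I E) ?B ?\<Phi>) = sets (Pi\<^sub>M I N)"
      unfolding sets_distr by (intro sets_PiM_cong) (auto simp: N_def)
    fix A assume "\<And>i. i \<in> I \<Longrightarrow> A i \<in> sets (N i)"
    then have A: "\<And>i. i \<in> I \<Longrightarrow> A i \<in> sets M" by (simp add: N_def)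
    have "?\<Phi> -` Pi\<^sub>E I A \<inter> space (Pi\<^sub>M I E) = (\<Pi>\<^sub>E i\<in>I. g i -` A i \<inter> space (E i))"
      by (auto simp: space_PiM PiE_iff)
    moreover have "Pi\<^sub>E I A \<in> sets ?B"
      using A fin by (intro sets_PiM_I_finite) simp_all
    ultimately have "emeasure (distr (Pi\<^sub>M I E) ?B ?\<Phi>) (Pi\<^sub>E I A)
        = emeasure (Pi\<^sub>M I E) (\<Pi>\<^sub>E i\<in>I. g i -` A i \<inter> space (E i))"
      by (simp only: emeasure_distr[OF \<Phi>])
    also have "\<dots> = (\<Prod>i\<in>I. emeasure (E i) (g i -` A i \<inter> space (E i)))"
      by (rule E.emeasure_PiM[OF fin]) (rule measurable_sets[OF g A])
    also have "\<dots> = (\<Prod>i\<in>I. emeasure (N i) (A i))"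
      unfolding N_def by (intro prod.cong refl emeasure_distr[symmetric] g A)
    finally show "emeasure (distr (Pi\<^sub>M I E) ?B ?\<Phi>) (Pi\<^sub>E I A) = (\<Prod>i\<in>I. emeasure (N i) (A i))" .
  qed
  then show ?thesis by (simp only: N_def[abs_def])
qed

lemma distr_Pi_pmf_components:
  assumes fin: "finite I" and g: "\<And>i x. g i x \<in> space M"
  shows "distr (Pi_pmf I d p) (\<Pi>\<^sub>M i\<in>I. M) (\<lambda>x. \<lambda>i\<in>I. g i (x i)) = (\<Pi>\<^sub>M i\<in>I. distr (p i) M (g i))"
    (is "distr _ ?B ?\<Phi> = _")
proof -
  let ?P = "Pi_pmf I d p"
  define N where "N i = distr (p i) M (g i)" for i
  interpret N: product_prob_space N
    unfolding N_def by (intro product_prob_spaceI measure_pmf.prob_space_distr) (simp add: g)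
  have \<Phi>: "?\<Phi> \<in> measure_pmf ?P \<rightarrow>\<^sub>M ?B"
    using g by (auto simp: space_PiM PiE_iff)
  have "distr ?P ?B ?\<Phi> = Pi\<^sub>M I N"
  proof (rule N.PiM_eqI[OF fin])
    show "sets (distr ?P ?B ?\<Phi>) = sets (Pi\<^sub>M I N)"
      unfolding sets_distr by (intro sets_PiM_cong) (auto simp: N_def)
    fix A assume "\<And>i. i \<in> I \<Longrightarrow> A i \<in> sets (N i)"
    then have A: "\<And>i. i \<in> I \<Longrightarrow> A i \<in> sets M" by (simp add: N_def)
    have "Pi\<^sub>E I A \<in> sets ?B"
      using A fin by (intro sets_PiM_I_finite) simp_all
    then have "emeasure (distr ?P ?B ?\<Phi>) (Pi\<^sub>E I A) = emeasure ?P (?\<Phi> -` Pi\<^sub>E I A)"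
      by (subst emeasure_distr[OF \<Phi>]) simp_all
    also have "\<dots> = emeasure ?P (PiE_dflt I d (\<lambda>i. g i -` A i))"
    proof (intro emeasure_eq_AE AE_pmfI)
      fix x assume "x \<in> set_pmf ?P"
      then have "\<forall>i. i \<notin> I \<longrightarrow> x i = d"
        using set_Pi_pmf_subset[OF fin, of d p] by blast
      then show "x \<in> ?\<Phi> -` Pi\<^sub>E I A \<longleftrightarrow> x \<in> PiE_dflt I d (\<lambda>i. g i -` A i)"
        by (auto simp: PiE_iff PiE_dflt_def)
    qed simp_all
    also have "\<dots> = (\<Prod>i\<in>I. emeasure (p i) (g i -` A i))"
      by (simp add: measure_pmf.emeasure_eq_measure measure_Pi_pmf_PiE_dflt fin prod_ennreal)
    also have "\<dots> = (\<Prod>i\<in>I. emeasure (N i) (A i))"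
      using g by (intro prod.cong refl) (simp add: N_def emeasure_distr A)
    finally show "emeasure (distr ?P ?B ?\<Phi>) (Pi\<^sub>E I A) = (\<Prod>i\<in>I. emeasure (N i) (A i))" .
  qed
  then show ?thesis by (simp only: N_def[abs_def])
qed

lemma scaled_law_Pi_geometric:
  assumes l: "\<And>i. i \<in> {1..k} \<Longrightarrow> 0 < l i" and \<rho>: "\<And>i. i \<in> {1..k} \<Longrightarrow> 0 < \<rho> i \<and> \<rho> i < 1"
  shows "scaled_law k c (Pi_pmf {1..k} d (\<lambda>i. geometric_pmf (1 - \<rho> i)))
       = distr (\<Pi>\<^sub>M i\<in>{1..k}. density lborel (exponential_density (l i))) (\<Pi>\<^sub>M i\<in>{1..k}. borel)
           (\<lambda>x. \<lambda>i\<in>{1..k}. real_of_int \<lfloor>x i / (- ln (\<rho> i) / l i)\<rfloor> / c)"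
proof -
  let ?I = "{1..k}"
  define g where "g i x = real_of_int \<lfloor>x / (- ln (\<rho> i) / l i)\<rfloor> / c" for i x
  define E where "E i = density lborel (exponential_density (if i \<in> ?I then l i else 1))" for i
  have prob: "prob_space (E i)" for i
    unfolding E_def by (rule prob_space_exponential_density) (use l in auto)
  have meas: "g i \<in> E i \<rightarrow>\<^sub>M borel" for i
    unfolding E_def g_def by measurable
  have "scaled_law k c (Pi_pmf ?I d (\<lambda>i. geometric_pmf (1 - \<rho> i)))
      = (\<Pi>\<^sub>M i\<in>?I. distr (geometric_pmf (1 - \<rho> i)) borel (\<lambda>m. real m / c))"
    unfolding scaled_law_def by (rule distr_Pi_pmf_components) simp_all
  also have "\<dots> = (\<Pi>\<^sub>M i\<in>?I. distr (E i) borel (g i))"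
  proof (rule PiM_cong[OF refl])
    fix i assume i: "i \<in> ?I"
    then have E: "E i = density lborel (exponential_density (l i))" unfolding E_def by simp
    show "distr (geometric_pmf (1 - \<rho> i)) borel (\<lambda>m. real m / c) = distr (E i) borel (g i)"
      unfolding E g_def using i l \<rho> by (intro distr_geometric_eq_distr_exponential) auto
  qed
  also have "\<dots> = distr (Pi\<^sub>M ?I E) (\<Pi>\<^sub>M i\<in>?I. borel) (\<lambda>x. \<lambda>i\<in>?I. g i (x i))"
    by (rule distr_PiM_components[symmetric]) (simp_all add: prob meas)
  also have "Pi\<^sub>M ?I E = (\<Pi>\<^sub>M i\<in>?I. density lborel (exponential_density (l i)))"
    by (intro PiM_cong) (auto simp: E_def)
  finally show ?thesis unfolding g_def .
qed

text \<open>
  Borel sets and product-measurable sets are known to agree on the full function space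
  over a countable index type. The lemma is reduced to that case by restricting
  functions to \<open>I\<close> in one direction and extending them by \<open>0\<close> in the other.
\<close>

lemma continuous_map_borel_measurable_PiM:
  fixes f :: "(nat \<Rightarrow> real) \<Rightarrow> real"
  assumes f: "continuous_map (product_topology (\<lambda>i. euclideanreal) I) euclideanreal f"
  shows "f \<in> borel_measurable (\<Pi>\<^sub>M i\<in>I. borel)"
proof -
  define g where "g x = f (restrict x I)" for x
  have "continuous_map (product_topology (\<lambda>i. euclideanreal) UNIV) (product_topology (\<lambda>i. euclideanreal) I)
      (\<lambda>x. restrict x I)"
    by (auto simp: continuous_map_componentwise intro: continuous_map_product_projection)
  from continuous_map_compose[OF this f] have "continuous_map euclidean euclideanreal g"
    by (simp add: o_def g_def[abs_def] euclidean_product_topology)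
  then have "g \<in> borel_measurable borel"
    by (intro borel_measurable_continuous_onI) simp
  then have g: "g \<in> borel_measurable (\<Pi>\<^sub>M i\<in>UNIV. borel)"
    by (simp add: measurable_cong_sets[OF sets_PiM_equal_borel refl])
  have e: "(\<lambda>x i. if i \<in> I then x i else 0) \<in> (\<Pi>\<^sub>M i\<in>I. borel) \<rightarrow>\<^sub>M (\<Pi>\<^sub>M i\<in>UNIV. (borel :: real measure))"
  proof (rule measurable_PiM_single')
    fix i :: nat
    show "(\<lambda>x. if i \<in> I then x i else 0) \<in> (\<Pi>\<^sub>M i\<in>I. borel) \<rightarrow>\<^sub>M (borel :: real measure)"
      by (cases "i \<in> I") auto
  qed auto
  have "(\<lambda>x. g (\<lambda>i. if i \<in> I then x i else 0)) \<in> borel_measurable (\<Pi>\<^sub>M i\<in>I. borel)"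
    by (rule measurable_compose[OF e g])
  moreover have "g (\<lambda>i. if i \<in> I then x i else 0) = f x" if "x \<in> space (\<Pi>\<^sub>M i\<in>I. borel)" for x
  proof -
    have "restrict (\<lambda>i. if i \<in> I then x i else 0) I = x"
      using that by (auto simp: space_PiM PiE_iff extensional_def fun_eq_iff)
    then show ?thesis by (simp add: g_def)
  qed
  ultimately show ?thesis by (simp cong: measurable_cong)
qed

lemma floor_quotient_tendsto:
  assumes c: "filterlim c at_top sequentially" and s: "(\<lambda>n. c n * s n) \<longlonglongrightarrow> 1"
  shows "(\<lambda>n. real_of_int \<lfloor>x / s n\<rfloor> / c n) \<longlonglongrightarrow> x"
proof -
  have ci: "(\<lambda>n. 1 / c n) \<longlonglongrightarrow> 0"
    using tendsto_divide_0[OF tendsto_const filterlim_at_top_imp_at_infinity[OF c]] .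
  have "(\<lambda>n. x / (c n * s n)) \<longlonglongrightarrow> x / 1"
    by (intro tendsto_divide tendsto_const s) simp
  then have up: "(\<lambda>n. x / (c n * s n)) \<longlonglongrightarrow> x" by simp
  have lo: "(\<lambda>n. x / (c n * s n) - 1 / c n) \<longlonglongrightarrow> x"
    using tendsto_diff[OF up ci] by simp
  have pos: "\<forall>\<^sub>F n in sequentially. 0 < c n"
    using c by (simp add: filterlim_at_top_dense)
  show ?thesis
  proof (rule tendsto_sandwich[OF _ _ lo up])
    show "\<forall>\<^sub>F n in sequentially. x / (c n * s n) - 1 / c n \<le> real_of_int \<lfloor>x / s n\<rfloor> / c n"
      using pos
    proof eventually_elim
      case (elim n)
      have "(x / s n - 1) / c n \<le> real_of_int \<lfloor>x / s n\<rfloor> / c n"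
        using elim by (intro divide_right_mono) linarith+
      then show ?case by (simp add: diff_divide_distrib mult.commute)
    qed
    show "\<forall>\<^sub>F n in sequentially. real_of_int \<lfloor>x / s n\<rfloor> / c n \<le> x / (c n * s n)"
      using pos
    proof eventually_elim
      case (elim n)
      have "real_of_int \<lfloor>x / s n\<rfloor> / c n \<le> (x / s n) / c n"
        using elim by (intro divide_right_mono) linarith+
      then show ?case by (simp add: mult.commute)
    qed
  qed
qed

lemma continuous_map_product_tendsto:
  assumes f: "continuous_map (product_topology (\<lambda>i. euclideanreal) I) euclideanreal f"
    and y: "\<And>n. y n \<in> extensional I" "z \<in> extensional I"
    and lim: "\<And>i. i \<in> I \<Longrightarrow> (\<lambda>n. y n i) \<longlonglongrightarrow> z i"
  shows "(\<lambda>n. f (y n)) \<longlonglongrightarrow> f z"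
proof -
  have "limitin (product_topology (\<lambda>i. euclideanreal) I) y z sequentially"
    using y lim by (auto simp: limitin_componentwise PiE_iff)
  from continuous_map_limit[OF f this] show ?thesis
    by (simp add: o_def)
qed

text \<open>
  All the scaled geometric vectors are realised on the single probability space that
  carries the exponential limit vector, by rounding the latter coordinatewise to a
  grid. On that space the convergence holds pointwise, so dominated convergence
  gives weak convergence without any discussion of tightness or distribution
  functions.
\<close>

lemma weakly_converges_scaled_geometric:
  assumes l: "\<And>i. i \<in> {1..k} \<Longrightarrow> 0 < l i"
    and \<rho>: "\<forall>\<^sub>F n in sequentially. \<forall>i\<in>{1..k}. 0 < \<rho> n i \<and> \<rho> n i < 1"
    and c: "filterlim c at_top sequentially"
    and lim: "\<And>i. i \<in> {1..k} \<Longrightarrow> (\<lambda>n. c n * - ln (\<rho> n i)) \<longlonglongrightarrow> l i"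
    and p: "\<forall>\<^sub>F n in sequentially. p n = Pi_pmf {1..k} d (\<lambda>i. geometric_pmf (1 - \<rho> n i))"
  shows "weakly_converges_in (product_topology (\<lambda>i. euclideanreal) {1..k})
           (\<lambda>n. scaled_law k (c n) (p n)) (\<Pi>\<^sub>M i\<in>{1..k}. density lborel (exponential_density (l i)))"
  unfolding weakly_converges_in_def
proof (intro allI impI, elim conjE)
  let ?I = "{1..k}" and ?X = "product_topology (\<lambda>i. euclideanreal) {1..k}"
  let ?E = "\<Pi>\<^sub>M i\<in>{1..k}. density lborel (exponential_density (l i))"
  fix f assume f: "continuous_map ?X euclideanreal f" and bnd: "bounded (f ` topspace ?X)"
  have fm: "f \<in> borel_measurable (\<Pi>\<^sub>M i\<in>?I. borel)"
    by (rule continuous_map_borel_measurable_PiM[OF f])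
  define \<Phi> where "\<Phi> n x = (\<lambda>i\<in>?I. real_of_int \<lfloor>x i / (- ln (\<rho> n i) / l i)\<rfloor> / c n)" for n and x :: "nat \<Rightarrow> real"
  have sets: "sets ?E = sets (\<Pi>\<^sub>M i\<in>?I. borel)"
    by (intro sets_PiM_cong) auto
  have \<Phi>: "\<Phi> n \<in> ?E \<rightarrow>\<^sub>M (\<Pi>\<^sub>M i\<in>?I. borel)" for n
    unfolding \<Phi>_def measurable_cong_sets[OF sets refl] by measurable
  obtain C where C: "\<And>x. x \<in> topspace ?X \<Longrightarrow> norm (f x) \<le> C"
    using bnd by (auto simp: bounded_iff)
  interpret E: prob_space ?E
    by (intro prob_space_PiM prob_space_exponential_density l)
  have "(\<lambda>n. \<integral>x. f (\<Phi> n x) \<partial>?E) \<longlonglongrightarrow> (\<integral>x. f x \<partial>?E)"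
  proof (rule integral_dominated_convergence[where w = "\<lambda>_. C"])
    show "f \<in> borel_measurable ?E"
      using fm by (simp add: measurable_cong_sets[OF sets refl])
    show "(\<lambda>x. f (\<Phi> n x)) \<in> borel_measurable ?E" for n
      by (rule measurable_compose[OF \<Phi> fm])
    show "AE x in ?E. norm (f (\<Phi> n x)) \<le> C" for n
      by (intro always_eventually allI C) (auto simp: \<Phi>_def)
    show "AE x in ?E. (\<lambda>n. f (\<Phi> n x)) \<longlonglongrightarrow> f x"
    proof (rule AE_I2)
      fix x assume "x \<in> space ?E"
      then have x: "x \<in> extensional ?I" by (simp add: space_PiM PiE_iff)
      show "(\<lambda>n. f (\<Phi> n x)) \<longlonglongrightarrow> f x"
      proof (rule continuous_map_product_tendsto[OF f _ x])
        fix i assume i: "i \<in> ?I"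
        have "(\<lambda>n. (c n * - ln (\<rho> n i)) / l i) \<longlonglongrightarrow> l i / l i"
          by (intro tendsto_divide lim i tendsto_const) (use l[OF i] in simp)
        then have "(\<lambda>n. c n * (- ln (\<rho> n i) / l i)) \<longlonglongrightarrow> 1"
          using l[OF i] by simp
        from floor_quotient_tendsto[OF c this] i
        show "(\<lambda>n. \<Phi> n x i) \<longlonglongrightarrow> x i" by (simp add: \<Phi>_def)
      qed (auto simp: \<Phi>_def)
    qed
  qed (rule E.integrable_const)
  moreover have "\<forall>\<^sub>F n in sequentially. (\<integral>x. f (\<Phi> n x) \<partial>?E) = (\<integral>x. f x \<partial>scaled_law k (c n) (p n))"
    using \<rho> p
  proof eventually_elim
    case (elim n)
    have "scaled_law k (c n) (p n) = distr ?E (\<Pi>\<^sub>M i\<in>?I. borel) (\<Phi> n)"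
      unfolding elim(2) \<Phi>_def by (rule scaled_law_Pi_geometric) (use l elim in auto)
    then show ?case using integral_distr[OF \<Phi> fm] by simp
  qed
  ultimately show "(\<lambda>n. \<integral>x. f x \<partial>scaled_law k (c n) (p n)) \<longlonglongrightarrow> (\<integral>x. f x \<partial>?E)"
    by (rule Lim_transform_eventually)
qed

section \<open>Heavy traffic\<close>

lemma heavy_traffic_limit: "(\<lambda>n. sqrt (real n) * - ln (1 - b / sqrt (real n))) \<longlonglongrightarrow> b"
  by real_asymp

text \<open>
  The bound \<open>1 - x \<le> exp (- x)\<close> turns the product into the exponential of a negative
  sum. It is not asymptotic, which is why stability of the network holds for every
  scale at which the rates are positive and not only for large ones.
\<close>

lemma prod_one_minus_less_1:
  fixes b :: "nat \<Rightarrow> real"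
  assumes "\<And>j. j \<in> A \<Longrightarrow> 0 < 1 - b j" "0 < (\<Sum>j\<in>A. b j)"
  shows "(\<Prod>j\<in>A. 1 - b j) < 1"
proof -
  have "finite A" by (rule ccontr) (use assms(2) in simp)
  have "(\<Prod>j\<in>A. 1 - b j) \<le> (\<Prod>j\<in>A. exp (- b j))"
  proof (rule prod_mono)
    fix j assume "j \<in> A"
    with assms(1) exp_ge_add_one_self[of "- b j"] show "0 \<le> 1 - b j \<and> 1 - b j \<le> exp (- b j)"
      by (metis less_imp_le add_uminus_conv_diff)
  qed
  also have "\<dots> = exp (- (\<Sum>j\<in>A. b j))"
    unfolding sum_negf[symmetric] by (rule exp_sum[OF \<open>finite A\<close>, symmetric])
  also have "\<dots> < 1" using assms by simp
  finally show ?thesis .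
qed

lemma ln_prod_heavy_traffic_limit:
  fixes a :: "nat \<Rightarrow> real"
  assumes "finite A"
  shows "(\<lambda>n. sqrt (real n) * - ln (\<Prod>j\<in>A. 1 - a j / sqrt (real n))) \<longlonglongrightarrow> (\<Sum>j\<in>A. a j)"
proof -
  have "(\<lambda>n. \<Sum>j\<in>A. sqrt (real n) * - ln (1 - a j / sqrt (real n))) \<longlonglongrightarrow> (\<Sum>j\<in>A. a j)"
    by (intro tendsto_sum heavy_traffic_limit)
  moreover have "\<forall>\<^sub>F n in sequentially. (\<Sum>j\<in>A. sqrt (real n) * - ln (1 - a j / sqrt (real n)))
      = sqrt (real n) * - ln (\<Prod>j\<in>A. 1 - a j / sqrt (real n))"
  proof -
    have "\<forall>\<^sub>F n in sequentially. 0 < 1 - a j / sqrt (real n)" for j by real_asymp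
    then have "\<forall>\<^sub>F n in sequentially. \<forall>j\<in>A. 0 < 1 - a j / sqrt (real n)"
      using assms by (simp add: eventually_ball_finite)
    then show ?thesis
    proof eventually_elim
      case (elim n)
      have "ln (\<Prod>j\<in>A. 1 - a j / sqrt (real n)) = (\<Sum>j\<in>A. ln (1 - a j / sqrt (real n)))"
        by (rule ln_prod) (use assms in simp, metis elim less_irrefl)
      then show ?case by (simp only: sum_distrib_left sum_negf mult_minus_right)
    qed
  qed
  ultimately show ?thesis by (rule Lim_transform_eventually)
qed

lemma gap_load_heavy_traffic:
  assumes "0 < n"
  shows "gap_load k (\<lambda>i. real n - a i * sqrt (real n)) (\<lambda>i. real n) i
       = (\<Prod>j=i..k. 1 - a j / sqrt (real n))"
  unfolding gap_load_def
proof (rule prod.cong[OF refl])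
  fix j
  have "a j * sqrt (real n) / (sqrt (real n) * sqrt (real n)) = a j / sqrt (real n)"
    using assms by (intro nonzero_mult_divide_mult_cancel_right) simp
  then show "(real n - a j * sqrt (real n)) / real n = 1 - a j / sqrt (real n)"
    using assms by (simp add: diff_divide_distrib)
qed

theorem corollary2p9:
  fixes k :: nat and a :: "nat \<Rightarrow> real"
    and P :: "nat \<Rightarrow> real \<Rightarrow> (nat \<Rightarrow> nat) \<Rightarrow> (nat \<Rightarrow> nat) pmf"
  assumes "k \<ge> 1"
    and "\<And>i. i \<in> {1..k} \<Longrightarrow> (\<Sum>j=i..k. a j) > 0"
    and "\<And>n. (\<forall>i\<in>{1..k}. real n - a i * sqrt (real n) > 0) \<Longrightarrow>
           ctmc (states k)
             (gap_jackson_rate k (\<lambda>i. real n - a i * sqrt (real n)) (\<lambda>i. real n)) (P n)"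
  shows "(\<forall>n. (\<forall>i\<in>{1..k}. real n - a i * sqrt (real n) > 0) \<longrightarrow>
            (\<exists>!p. stationary_for (states k) (P n) p)) \<and>
         weakly_converges_in (product_topology (\<lambda>i. euclideanreal) {1..k})
           (\<lambda>n. scaled_law k (sqrt (real n)) (stationary_distribution (states k) (P n)))
           (\<Pi>\<^sub>M i\<in>{1..k}. density lborel (exponential_density (\<Sum>j=i..k. a j)))"
proof -
  define ok where "ok n \<longleftrightarrow> (\<forall>i\<in>{1..k}. real n - a i * sqrt (real n) > 0)" for n
  define \<rho> where "\<rho> n i = (\<Prod>j=i..k. 1 - a j / sqrt (real n))" for n :: nat and i
  have n_pos: "0 < n" if "ok n" for n
  proof (rule ccontr)
    assume "\<not> 0 < n"
    with that assms(1) show False by (simp add: ok_def)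
  qed
  have factor: "0 < 1 - a i / sqrt (real n)" if "ok n" "i \<in> {1..k}" for n i
  proof -
    have "a i * sqrt (real n) < sqrt (real n) * sqrt (real n)"
      using that by (simp add: ok_def)
    then have "a i < sqrt (real n)" by (rule mult_right_less_imp_less) simp
    then show ?thesis using n_pos[OF that(1)] by simp
  qed
  have \<rho>: "0 < \<rho> n i \<and> \<rho> n i < 1" if "ok n" "i \<in> {1..k}" for n i
  proof
    have fac: "0 < 1 - a j / sqrt (real n)" if "j \<in> {i..k}" for j
      using factor[OF \<open>ok n\<close>, of j] that \<open>i \<in> {1..k}\<close> by simp
    then show "0 < \<rho> n i" unfolding \<rho>_def by (intro prod_pos) simp
    have "0 < (\<Sum>j=i..k. a j / sqrt (real n))"
      using assms(2)[OF that(2)] n_pos[OF that(1)] by (simp add: sum_divide_distrib[symmetric])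
    with fac show "\<rho> n i < 1" unfolding \<rho>_def by (rule prod_one_minus_less_1)
  qed
  have stationary: "stationary_for (states k) (P n) p \<longleftrightarrow> p = geometric_product k (\<rho> n)"
    if "ok n" for n p
  proof -
    have load: "gap_load k (\<lambda>i. real n - a i * sqrt (real n)) (\<lambda>i. real n) = \<rho> n"
      unfolding \<rho>_def by (intro ext gap_load_heavy_traffic n_pos that)
    show ?thesis
      unfolding load[symmetric]
      by (rule gap_jackson_stationary_iff)
        (use that n_pos[OF that] \<rho>[OF that] assms(1,3) in \<open>auto simp: ok_def load\<close>)
  qed
  have ev: "\<forall>\<^sub>F n in sequentially. ok n"
  proof -
    have "\<forall>\<^sub>F n in sequentially. real n - a i * sqrt (real n) > 0" for i by real_asymp
    then show ?thesis unfolding ok_def by (simp add: eventually_ball_finite)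
  qed
  have "weakly_converges_in (product_topology (\<lambda>i. euclideanreal) {1..k})
           (\<lambda>n. scaled_law k (sqrt (real n)) (stationary_distribution (states k) (P n)))
           (\<Pi>\<^sub>M i\<in>{1..k}. density lborel (exponential_density (\<Sum>j=i..k. a j)))"
  proof (rule weakly_converges_scaled_geometric[where \<rho> = \<rho> and d = undefined])
    show "\<forall>\<^sub>F n in sequentially. \<forall>i\<in>{1..k}. 0 < \<rho> n i \<and> \<rho> n i < 1"
      using ev by eventually_elim (use \<rho> in blast)
    show "filterlim (\<lambda>n. sqrt (real n)) at_top sequentially" by real_asymp
    show "(\<lambda>n. sqrt (real n) * - ln (\<rho> n i)) \<longlonglongrightarrow> (\<Sum>j=i..k. a j)" for i
      unfolding \<rho>_def by (rule ln_prod_heavy_traffic_limit) simp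
    show "\<forall>\<^sub>F n in sequentially. stationary_distribution (states k) (P n)
        = Pi_pmf {1..k} undefined (\<lambda>i. geometric_pmf (1 - \<rho> n i))"
      using ev
      by eventually_elim (simp add: stationary_distribution_def stationary geometric_product_def)
  qed (use assms(2) in auto)
  moreover have "\<exists>!p. stationary_for (states k) (P n) p" if "ok n" for n
    by (simp add: stationary[OF that])
  ultimately show ?thesis unfolding ok_def by blast
qed

end
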